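(* Let $r>0$. The mean distance $M_1$ between two uniformly and independently distributed random points in the regular pentagon $\mathcal{P}_{5,r}$ satisfies $$\frac{M_1}{r}=\frac{\sqrt2}{480}\sqrt{5+\sqrt5}\,\left[24\sqrt5-8-\left(35+9\sqrt5\right)\ln5-2\left(25+11\sqrt5\right)\ln\left(\sqrt5-2\right)\right].$$
   Context: $\mathcal{P}_{n,r}$ is the (filled) regular polygon with $n$ sides whose circumscribed circle has radius $r$. The mean distance $M_1$ is the expected Euclidean distance between two points chosen independently and uniformly (w.r.t. area) from the polygon. *)

theory Defs
  imports "HOL-Analysis.Analysis"
begin

text \<open>
  The plane is modelled by the type \<^typ>\<open>complex\<close>. The polygon with \<open>n\<close> sides and circumradius
  \<open>r\<close> is determined up to congruence, so its centre \<open>c\<close> and the angle \<open>\<theta>\<close> of its first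
  vertex are parameters.
\<close>

definition regular_polygon :: "nat \<Rightarrow> real \<Rightarrow> complex \<Rightarrow> real \<Rightarrow> complex set" where
  "regular_polygon n r c \<theta> =
     convex hull ((\<lambda>k. c + rcis r (\<theta> + 2 * pi * real k / real n)) ` {..<n})"

text \<open>
  Intended for Borel sets \<open>S\<close> of finite positive measure, where \<^term>\<open>uniform_measure lborel S\<close>
  is a probability measure; independence of the two points is expressed by the product measure.
\<close>

definition mean_distance :: "complex set \<Rightarrow> real" where
  "mean_distance S =
     (LINT (x, y)|(uniform_measure lborel S \<Otimes>\<^sub>M uniform_measure lborel S). dist x y)"

end

(*
  For a polygon P and an apex p in P, cut P into triangles with apex p and write each point as
  p + t (e - p) with e on the far side of its triangle and 0 <= t <= 1.  In the double integral of
  |x - y| over P x P scale by the larger of the two parameters t: this moves one of the points to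
  the boundary, and the scale factor integrates out to 1/5 (twice).  With p a vertex and the
  rotational symmetry of the pentagon, there remains the integral of F(z) = int_P |z - y| dy over
  one side.  For z on that side cut P into triangles with apex z: the radial integral gives 1/3, and
  F(z) becomes a sum of integrals of |z - w| over the other four sides.  So only the double integrals
  of u * sqrt(u^2 + v^2 - 2 c u v) over pairs of sides are left, where u and v are the distances to
  the point in which the lines through the sides meet.  The integrand is homogeneous, so these
  integrals reduce to an antiderivative of (1 + x) * sqrt(1 + x^2 - 2 c x), which is elementary.
*)
theory Submission
  imports Defs
begin

subsection \<open>Lebesgue measure on the complex plane\<close>

text \<open>All integrals are taken in \<open>ennreal\<close>, so that Tonelli and substitution
  raise no integrability questions. With a vertex as apex the triangles over the two sides through
  it are degenerate; the other three sides carry equal integrals of F by rotation, and their weights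
  add up to twice the area. The factor u in the reduced integrand is the height of z over the other
  side line, which grows linearly with the distance to the meeting point. Adding the halves u >= v
  and v >= u yields the weight 1 + x in the ratio x. Adjacent sides give a full unit square.
  Non-adjacent sides start away from the meeting point; this cut-off a leaves the weight (1 -
  (a/x)^4) / 4, and its second part is integrated by the inversion x -> 1/x, which leads back to the
  same antiderivative. Since a = 2 cos 72 degrees is the inverse golden ratio, the needed values of
  \<open>third_side\<close> and the arguments of the logarithms lie in Q(sqrt 5), where the
  arguments factor into 2, sqrt 5 and the golden ratio; only ln 5 and ln (sqrt 5 - 2)
  survive.\<close>

text \<open>Signed area of the parallelogram spanned by two vectors: it serves both as Jacobian
  determinant and as orientation test.\<close>

definition cross :: "complex \<Rightarrow> complex \<Rightarrow> real" where
  "cross z w = Re z * Im w - Im z * Re w"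

lemma measurable_Complex_pair [measurable]:
  "(\<lambda>p. Complex (fst p) (snd p)) \<in> borel_measurable borel"
  unfolding complex_eq by (intro borel_measurable_continuous_onI continuous_intros)

lemma lborel_complex_eq_distr:
  "(lborel :: complex measure) = distr lborel borel (\<lambda>p. Complex (fst p) (snd p))"
proof (rule lborel_eqI)
  fix l u :: complex
  assume le: "\<And>b. b \<in> Basis \<Longrightarrow> l \<bullet> b \<le> u \<bullet> b"
  have 1: "Re l \<le> Re u" "Im l \<le> Im u"
    using le[of 1] le[of \<i>] by (auto simp: Basis_complex_def)
  have "emeasure (distr lborel borel (\<lambda>p. Complex (fst p) (snd p))) (box l u)
      = emeasure lborel ((\<lambda>p. Complex (fst p) (snd p)) -` box l u)"
    by (subst emeasure_distr) auto
  also have "(\<lambda>p. Complex (fst p) (snd p)) -` box l u = box (Re l, Im l) (Re u, Im u)"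
    by (auto simp: box_def Basis_complex_def Basis_prod_def)
  also have "emeasure lborel \<dots> = ennreal (\<Prod>b\<in>Basis. (u - l) \<bullet> b)"
    using 1 by (subst emeasure_lborel_box) (auto simp: Basis_complex_def Basis_prod_def)
  finally show "emeasure (distr lborel borel (\<lambda>p. Complex (fst p) (snd p))) (box l u)
      = ennreal (\<Prod>b\<in>Basis. (u - l) \<bullet> b)" .
qed auto

lemma nn_integral_complex:
  assumes [measurable]: "f \<in> borel_measurable borel"
  shows "(\<integral>\<^sup>+z. f z \<partial>lborel) = (\<integral>\<^sup>+x. \<integral>\<^sup>+y. f (Complex x y) \<partial>lborel \<partial>lborel)"
proof -
  have "(\<integral>\<^sup>+z. f z \<partial>lborel) = (\<integral>\<^sup>+p. f (Complex (fst p) (snd p)) \<partial>lborel)"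
    by (subst lborel_complex_eq_distr, subst nn_integral_distr) auto
  also have "\<dots> = (\<integral>\<^sup>+p. f (Complex (fst p) (snd p)) \<partial>(lborel \<Otimes>\<^sub>M lborel))"
    by (simp add: lborel_prod)
  also have "\<dots> = (\<integral>\<^sup>+x. \<integral>\<^sup>+y. f (Complex x y) \<partial>lborel \<partial>lborel)"
    by (subst lborel.nn_integral_fst[symmetric]) (auto simp: lborel_prod)
  finally show ?thesis .
qed

text \<open>With pivot \<open>a\<close> the map factors into two one-dimensional substitutions:
  first y with x fixed, with factor k = det / a, then x with y fixed, with factor \<open>a\<close>.
  The product of the factors is the determinant.\<close>

lemma nn_integral_linear_prod_aux:
  fixes a b c d :: real and f :: "real \<times> real \<Rightarrow> ennreal"
  assumes [measurable]: "f \<in> borel_measurable borel" and a: "a \<noteq> 0" and D: "a * d - b * c \<noteq> 0"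
  shows "(\<integral>\<^sup>+x. \<integral>\<^sup>+y. f (x, y) \<partial>lborel \<partial>lborel) =
    ennreal \<bar>a * d - b * c\<bar> * (\<integral>\<^sup>+x. \<integral>\<^sup>+y. f (a * x + b * y, c * x + d * y) \<partial>lborel \<partial>lborel)"
proof -
  define k where "k = (a * d - b * c) / a"
  have k: "k \<noteq> 0" using a D by (simp add: k_def)
  have [measurable]: "f \<in> borel_measurable (borel \<Otimes>\<^sub>M borel)" by (simp add: borel_prod)
  have "(\<integral>\<^sup>+x. \<integral>\<^sup>+y. f (x, y) \<partial>lborel \<partial>lborel)
      = (\<integral>\<^sup>+x. \<bar>k\<bar> * (\<integral>\<^sup>+y. f (x, c / a * x + k * y) \<partial>lborel) \<partial>lborel)"
    by (intro nn_integral_cong nn_integral_real_affine k) measurable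
  also have "\<dots> = \<bar>k\<bar> * (\<integral>\<^sup>+x. \<integral>\<^sup>+y. f (x, c / a * x + k * y) \<partial>lborel \<partial>lborel)"
    by (intro nn_integral_cmult) measurable
  also have "(\<integral>\<^sup>+x. \<integral>\<^sup>+y. f (x, c / a * x + k * y) \<partial>lborel \<partial>lborel)
      = (\<integral>\<^sup>+y. \<integral>\<^sup>+x. f (x, c / a * x + k * y) \<partial>lborel \<partial>lborel)"
    by (rule lborel_pair.Fubini'[symmetric]) measurable
  also have "\<dots> = (\<integral>\<^sup>+y. \<bar>a\<bar> * (\<integral>\<^sup>+x. f (b * y + a * x, c / a * (b * y + a * x) + k * y) \<partial>lborel) \<partial>lborel)"
    by (intro nn_integral_cong nn_integral_real_affine a) measurable
  also have "\<dots> = \<bar>a\<bar> * (\<integral>\<^sup>+y. \<integral>\<^sup>+x. f (b * y + a * x, c / a * (b * y + a * x) + k * y) \<partial>lborel \<partial>lborel)"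
    by (intro nn_integral_cmult) measurable
  also have "(\<integral>\<^sup>+y. \<integral>\<^sup>+x. f (b * y + a * x, c / a * (b * y + a * x) + k * y) \<partial>lborel \<partial>lborel)
      = (\<integral>\<^sup>+y. \<integral>\<^sup>+x. f (a * x + b * y, c * x + d * y) \<partial>lborel \<partial>lborel)"
    using a by (intro nn_integral_cong arg_cong[of _ _ f]) (auto simp: k_def field_simps)
  also have "\<dots> = (\<integral>\<^sup>+x. \<integral>\<^sup>+y. f (a * x + b * y, c * x + d * y) \<partial>lborel \<partial>lborel)"
    by (rule lborel_pair.Fubini') measurable
  moreover have "\<bar>k\<bar> * \<bar>a\<bar> = \<bar>a * d - b * c\<bar>"
    using a by (simp add: k_def abs_divide)
  ultimately show ?thesis
    by (simp add: mult.assoc[symmetric] ennreal_mult'[symmetric])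
qed

lemma nn_integral_linear_prod:
  fixes a b c d :: real and f :: "real \<times> real \<Rightarrow> ennreal"
  assumes [measurable]: "f \<in> borel_measurable borel" and D: "a * d - b * c \<noteq> 0"
  shows "(\<integral>\<^sup>+x. \<integral>\<^sup>+y. f (x, y) \<partial>lborel \<partial>lborel) =
    ennreal \<bar>a * d - b * c\<bar> * (\<integral>\<^sup>+x. \<integral>\<^sup>+y. f (a * x + b * y, c * x + d * y) \<partial>lborel \<partial>lborel)"
proof (cases "a = 0")
  case False
  then show ?thesis using nn_integral_linear_prod_aux[of f a d b c] D by simp
next
  \<comment> \<open>Here b is nonzero because the determinant is; exchanging the two integration
    variables makes b the pivot and only changes the sign of the determinant.\<close>
  case True
  have [measurable]: "f \<in> borel_measurable (borel \<Otimes>\<^sub>M borel)" by (simp add: borel_prod)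
  have "(\<integral>\<^sup>+x. \<integral>\<^sup>+y. f (a * x + b * y, c * x + d * y) \<partial>lborel \<partial>lborel)
      = (\<integral>\<^sup>+y. \<integral>\<^sup>+x. f (a * x + b * y, c * x + d * y) \<partial>lborel \<partial>lborel)"
    by (rule lborel_pair.Fubini'[symmetric]) measurable
  then show ?thesis
    using nn_integral_linear_prod_aux[of f b c a d] D True
    by (simp add: add.commute abs_minus_commute)
qed

lemma nn_integral_affine_complex:
  assumes [measurable]: "f \<in> borel_measurable borel" and D: "cross u v \<noteq> 0"
  shows "(\<integral>\<^sup>+z. f z \<partial>lborel) =
    ennreal \<bar>cross u v\<bar> * (\<integral>\<^sup>+x. \<integral>\<^sup>+y. f (p + of_real x * u + of_real y * v) \<partial>lborel \<partial>lborel)"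
proof -
  have "(\<integral>\<^sup>+z. f z \<partial>lborel) = (\<integral>\<^sup>+z. f (p + z) \<partial>lborel)"
    by (subst lborel_distr_plus[symmetric, of p], subst nn_integral_distr) auto
  also have "\<dots> = (\<integral>\<^sup>+x. \<integral>\<^sup>+y. f (p + Complex (fst (x, y)) (snd (x, y))) \<partial>lborel \<partial>lborel)"
    by (subst nn_integral_complex) auto
  also have "\<dots> = ennreal \<bar>Re u * Im v - Re v * Im u\<bar> *
      (\<integral>\<^sup>+x. \<integral>\<^sup>+y. f (p + (\<lambda>x y. Complex (Re u * x + Re v * y) (Im u * x + Im v * y)) x y) \<partial>lborel \<partial>lborel)"
    by (subst nn_integral_linear_prod[where a="Re u" and b="Re v" and c="Im u" and d="Im v"])
      (use D in \<open>auto simp: cross_def mult.commute\<close>)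
  also have "Re u * Im v - Re v * Im u = cross u v"
    by (simp add: cross_def)
  also have "(\<lambda>x y. Complex (Re u * x + Re v * y) (Im u * x + Im v * y)) = (\<lambda>x y. of_real x * u + of_real y * v)"
    by (simp add: complex_eq_iff fun_eq_iff)
  finally show ?thesis by (simp add: add.assoc)
qed

text \<open>Multiplication by \<open>a\<close> is the real linear map with columns a and i a, whose
  determinant is the squared norm of a.\<close>

lemma nn_integral_similarity:
  assumes [measurable]: "f \<in> borel_measurable borel" and a: "a \<noteq> (0::complex)"
  shows "(\<integral>\<^sup>+z. f z \<partial>lborel) = ennreal ((norm a)\<^sup>2) * (\<integral>\<^sup>+z. f (p + a * z) \<partial>lborel)"
proof -
  have c: "cross a (\<i> * a) = (norm a)\<^sup>2"
    by (simp add: cross_def cmod_power2, simp add: power2_eq_square)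
  have "(\<integral>\<^sup>+z. f (p + a * z) \<partial>lborel)
      = (\<integral>\<^sup>+x. \<integral>\<^sup>+y. f (p + of_real x * a + of_real y * (\<i> * a)) \<partial>lborel \<partial>lborel)"
    by (subst nn_integral_complex) (auto simp: Complex_eq algebra_simps)
  then show ?thesis
    using nn_integral_affine_complex[of f a "\<i> * a" p] c a by simp
qed

subsection \<open>Integrals over triangles\<close>

lemma cross_simps:
  "cross (a + b) c = cross a c + cross b c" "cross a (b + c) = cross a b + cross a c"
  "cross (a - b) c = cross a c - cross b c" "cross a (b - c) = cross a b - cross a c"
  "cross (of_real x * a) b = x * cross a b" "cross a (of_real x * b) = x * cross a b"
  "cross a a = 0" "cross 0 a = 0" "cross a 0 = 0"
  by (simp_all add: cross_def algebra_simps)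

text \<open>The coordinates are adapted to the apex p: x is the fraction of the way from p to the
  far side. The barycentric weights of u and v are x - y and y, which accounts for the three
  inequalities.\<close>

lemma triangle_coordinates_iff:
  assumes D: "cross (u - p) (v - p) \<noteq> 0"
  shows "p + of_real x * (u - p) + of_real y * (v - u) \<in> convex hull {p, u, v}
    \<longleftrightarrow> 0 \<le> y \<and> y \<le> x \<and> x \<le> 1"
proof -
  have eq: "p + of_real x * (u - p) + of_real y * (v - u)
      = p + ((x - y) *\<^sub>R (u - p) + y *\<^sub>R (v - p))"
    by (simp add: scaleR_conv_of_real algebra_simps)
  have "a = a' \<and> b = b'"
    if "a *\<^sub>R (u - p) + b *\<^sub>R (v - p) = a' *\<^sub>R (u - p) + b' *\<^sub>R (v - p)" for a b a' b'
  proof -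
    have "cross (u - p) (a *\<^sub>R (u - p) + b *\<^sub>R (v - p)) = cross (u - p) (a' *\<^sub>R (u - p) + b' *\<^sub>R (v - p))"
      "cross (a *\<^sub>R (u - p) + b *\<^sub>R (v - p)) (v - p) = cross (a' *\<^sub>R (u - p) + b' *\<^sub>R (v - p)) (v - p)"
      using that by simp_all
    then have "b * cross (u - p) (v - p) = b' * cross (u - p) (v - p)"
      "a * cross (u - p) (v - p) = a' * cross (u - p) (v - p)"
      unfolding scaleR_conv_of_real cross_simps(1,2,5,6,7) by simp_all
    with D show ?thesis by simp
  qed
  then show ?thesis
    unfolding eq convex_hull_3_alt by (force simp: add.assoc)
qed

text \<open>A probability measure on the whole line instead of \<^term>\<open>restrict_space lborel {0..1::real}\<close>:
  its measurable sets are the Borel sets, so Fubini's theorem applies without indicator functions.\<close>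

definition unit_measure :: "real measure" where
  "unit_measure = uniform_measure lborel {0..1}"

lemma sets_unit_measure [simp, measurable_cong]: "sets unit_measure = sets borel"
  and space_unit_measure [simp]: "space unit_measure = UNIV"
  by (simp_all add: unit_measure_def)

lemma emeasure_unit_measure_UNIV [simp]: "emeasure unit_measure UNIV = 1"
  by (simp add: unit_measure_def)

interpretation unit: finite_measure unit_measure
  by (rule finite_measureI) simp

interpretation unit_pair: pair_sigma_finite unit_measure unit_measure ..

lemma nn_integral_unit_measure:
  assumes [measurable]: "f \<in> borel_measurable borel"
  shows "(\<integral>\<^sup>+x. f x \<partial>unit_measure) = (\<integral>\<^sup>+x. f x * indicator {0..1} x \<partial>lborel)"
  unfolding unit_measure_def
  by (subst nn_integral_uniform_measure) (auto simp: divide_ennreal_def)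

lemma AE_unit_measure: "AE x in unit_measure. 0 < x \<and> x < 1"
proof -
  have "AE x in lborel. x \<noteq> (0::real)" "AE x in lborel. x \<noteq> (1::real)"
    by (rule AE_lborel_singleton)+
  then have "AE x in lborel. x \<in> {0..1} \<longrightarrow> 0 < x \<and> x < (1::real)"
    by eventually_elim auto
  then show ?thesis
    unfolding unit_measure_def by (subst AE_uniform_measure) auto
qed

lemma nn_integral_unit_FTC:
  fixes f F :: "real \<Rightarrow> real"
  assumes [measurable]: "f \<in> borel_measurable borel"
    and "\<And>x. 0 \<le> x \<Longrightarrow> x \<le> 1 \<Longrightarrow> (F has_real_derivative f x) (at x)"
    and "\<And>x. 0 \<le> x \<Longrightarrow> x \<le> 1 \<Longrightarrow> 0 \<le> f x"
  shows "(\<integral>\<^sup>+x. ennreal (f x) \<partial>unit_measure) = ennreal (F 1 - F 0)"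
  by (subst nn_integral_unit_measure) (use assms in \<open>auto intro!: nn_integral_FTC_Icc\<close>)

lemma nn_integral_unit_power:
  "(\<integral>\<^sup>+x. ennreal (x ^ n) \<partial>unit_measure) = ennreal (1 / (real n + 1))"
proof -
  have "((\<lambda>x. x ^ Suc n / (real n + 1)) has_real_derivative x ^ n) (at x)" for x
    by (rule DERIV_cong, (rule derivative_intros)+) (auto simp: divide_simps)
  then show ?thesis
    by (subst nn_integral_unit_FTC[where F = "\<lambda>x. x ^ Suc n / (real n + 1)"]) auto
qed

text \<open>In the coordinates of \<open>triangle_coordinates_iff\<close> the slice at height x is 0
  <= y <= x. Rescaling it by y = x s produces the Jacobian factor t of the conical
  parametrisation.\<close>

lemma nn_integral_triangle:
  assumes [measurable]: "f \<in> borel_measurable borel" and D: "cross (u - p) (v - p) \<noteq> 0"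
  shows "(\<integral>\<^sup>+z. f z * indicator (convex hull {p, u, v}) z \<partial>lborel) =
    ennreal \<bar>cross (u - p) (v - p)\<bar> * (\<integral>\<^sup>+t. ennreal t * (\<integral>\<^sup>+s. f (p + of_real t * ((1 - of_real s) * (u - p) + of_real s * (v - p))) \<partial>unit_measure) \<partial>unit_measure)"
proof -
  define T where "T = convex hull {p, u, v}"
  have [measurable]: "T \<in> sets borel"
    unfolding T_def by (intro borel_closed compact_imp_closed compact_convex_hull) auto
  have c: "cross (u - p) (v - p) = cross (u - p) (v - u)"
    by (simp add: cross_def algebra_simps)
  have "(\<integral>\<^sup>+z. f z * indicator T z \<partial>lborel) = ennreal \<bar>cross (u - p) (v - p)\<bar> *
    (\<integral>\<^sup>+x. \<integral>\<^sup>+y. f (p + of_real x * (u - p) + of_real y * (v - u)) *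
        indicator T (p + of_real x * (u - p) + of_real y * (v - u)) \<partial>lborel \<partial>lborel)"
    using D unfolding c by (intro nn_integral_affine_complex) auto
  also have "(\<integral>\<^sup>+x. \<integral>\<^sup>+y. f (p + of_real x * (u - p) + of_real y * (v - u)) *
        indicator T (p + of_real x * (u - p) + of_real y * (v - u)) \<partial>lborel \<partial>lborel)
    = (\<integral>\<^sup>+x. (ennreal x * (\<integral>\<^sup>+s. f (p + of_real x * ((1 - of_real s) * (u - p) + of_real s * (v - p))) \<partial>unit_measure)) * indicator {0..1} x \<partial>lborel)"
  proof (intro nn_integral_cong_AE)
    \<comment> \<open>The slice at the apex is excluded because the rescaling degenerates
      there.\<close>
    have "AE x in lborel. x \<noteq> (0::real)" by (rule AE_lborel_singleton)
    then show "AE x in lborel. (\<integral>\<^sup>+y. f (p + of_real x * (u - p) + of_real y * (v - u)) *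
        indicator T (p + of_real x * (u - p) + of_real y * (v - u)) \<partial>lborel) = (ennreal x * (\<integral>\<^sup>+s. f (p + of_real x * ((1 - of_real s) * (u - p) + of_real s * (v - p))) \<partial>unit_measure)) * indicator {0..1} x"
    proof eventually_elim
      case (elim x)
      show ?case
      proof (cases "0 < x \<and> x \<le> 1")
        case False
        then have "p + of_real x * (u - p) + of_real y * (v - u) \<notin> T" for y
          using elim unfolding T_def triangle_coordinates_iff[OF D] by auto
        then show ?thesis using False elim by (auto simp: indicator_def)
      next
        case True
        have "(\<integral>\<^sup>+y. f (p + of_real x * (u - p) + of_real y * (v - u)) *
            indicator T (p + of_real x * (u - p) + of_real y * (v - u)) \<partial>lborel)
          = (\<integral>\<^sup>+y. f (p + of_real x * (u - p) + of_real y * (v - u)) * indicator {0..x} y \<partial>lborel)"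
          unfolding T_def using True
          by (intro nn_integral_cong) (auto simp: indicator_def triangle_coordinates_iff[OF D])
        also have "\<dots> = ennreal \<bar>x\<bar> * (\<integral>\<^sup>+y. f (p + of_real x * (u - p) + of_real (0 + x * y) * (v - u)) * indicator {0..x} (0 + x * y) \<partial>lborel)"
          using elim by (intro nn_integral_real_affine) auto
        also have "(\<integral>\<^sup>+y. f (p + of_real x * (u - p) + of_real (0 + x * y) * (v - u)) * indicator {0..x} (0 + x * y) \<partial>lborel)
          = (\<integral>\<^sup>+y. f (p + of_real x * ((1 - of_real y) * (u - p) + of_real y * (v - p))) * indicator {0..1} y \<partial>lborel)"
          using True
          by (intro nn_integral_cong arg_cong2[of _ _ _ _ "(*)"] arg_cong[of _ _ f])
             (auto simp: indicator_def algebra_simps zero_le_mult_iff)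
        finally show ?thesis
          using True by (simp add: nn_integral_unit_measure)
      qed
    qed
  qed
  finally show ?thesis
    unfolding T_def by (subst nn_integral_unit_measure) auto
qed

text \<open>The square is cut along its diagonal. In each half t is the larger variable and s the
  ratio of the smaller one to it, which costs a factor t. Homogeneous integrands then
  separate.\<close>

lemma nn_integral_unit_square_split:
  assumes [measurable]: "case_prod g \<in> borel_measurable (borel \<Otimes>\<^sub>M borel)"
  shows "(\<integral>\<^sup>+t. \<integral>\<^sup>+s. g t s \<partial>unit_measure \<partial>unit_measure) =
    (\<integral>\<^sup>+t. ennreal t * (\<integral>\<^sup>+s. g t (t * s) + g (t * s) t \<partial>unit_measure) \<partial>unit_measure)"
proof -
  have sub: "(\<integral>\<^sup>+s. G s * (if 0 \<le> s \<and> s \<le> t then 1 else 0) \<partial>unit_measure) = ennreal t * (\<integral>\<^sup>+s. G (t * s) \<partial>unit_measure)"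
    if [measurable]: "G \<in> borel_measurable borel" and t: "0 < t" "t < 1" for G :: "real \<Rightarrow> ennreal" and t
  proof -
    have "(\<integral>\<^sup>+s. G s * (if 0 \<le> s \<and> s \<le> t then 1 else 0) \<partial>unit_measure) = (\<integral>\<^sup>+s. G s * (if 0 \<le> s \<and> s \<le> t then 1 else 0) \<partial>lborel)"
      using t by (subst nn_integral_unit_measure) (auto intro!: nn_integral_cong simp: indicator_def)
    also have "\<dots> = ennreal \<bar>t\<bar> * (\<integral>\<^sup>+s. G (0 + t * s) * (if 0 \<le> (0 + t * s) \<and> (0 + t * s) \<le> t then 1 else 0) \<partial>lborel)"
      using t by (intro nn_integral_real_affine) auto
    also have "(\<integral>\<^sup>+s. G (0 + t * s) * (if 0 \<le> (0 + t * s) \<and> (0 + t * s) \<le> t then 1 else 0) \<partial>lborel) = (\<integral>\<^sup>+s. G (t * s) \<partial>unit_measure)"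
      using t by (subst nn_integral_unit_measure)
        (auto intro!: nn_integral_cong simp: indicator_def zero_le_mult_iff)
    finally show ?thesis using t by simp
  qed
  have [measurable]: "g t \<in> borel_measurable borel" "(\<lambda>t. g t s) \<in> borel_measurable borel" for t s
    by measurable
  have "(\<integral>\<^sup>+t. \<integral>\<^sup>+s. g t s \<partial>unit_measure \<partial>unit_measure) =
    (\<integral>\<^sup>+t. (\<integral>\<^sup>+s. g t s * (if 0 \<le> s \<and> s \<le> t then 1 else 0) \<partial>unit_measure) + (\<integral>\<^sup>+s. g t s * (if 0 \<le> t \<and> t \<le> s then 1 else 0) \<partial>unit_measure) \<partial>unit_measure)"
  proof (rule nn_integral_cong_AE, use AE_unit_measure in eventually_elim)
    case (elim t)
    \<comment> \<open>The two closed halves overlap in the diagonal, which is null for each fixed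
      t.\<close>
    have "AE s in lborel. s \<noteq> t" by (rule AE_lborel_singleton)
    then have "AE s in unit_measure. s \<noteq> t"
      unfolding unit_measure_def by (subst AE_uniform_measure) auto
    with AE_unit_measure have "AE s in unit_measure. g t s = g t s * (if 0 \<le> s \<and> s \<le> t then 1 else 0) + g t s * (if 0 \<le> t \<and> t \<le> s then 1 else 0)"
      by eventually_elim (use elim in \<open>auto simp: indicator_def\<close>)
    then have "(\<integral>\<^sup>+s. g t s \<partial>unit_measure) = (\<integral>\<^sup>+s. g t s * (if 0 \<le> s \<and> s \<le> t then 1 else 0) + g t s * (if 0 \<le> t \<and> t \<le> s then 1 else 0) \<partial>unit_measure)"
      by (rule nn_integral_cong_AE)
    also have "\<dots> = (\<integral>\<^sup>+s. g t s * (if 0 \<le> s \<and> s \<le> t then 1 else 0) \<partial>unit_measure) + (\<integral>\<^sup>+s. g t s * (if 0 \<le> t \<and> t \<le> s then 1 else 0) \<partial>unit_measure)"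
      by (rule nn_integral_add) measurable
    finally show ?case .
  qed
  also have "\<dots> = (\<integral>\<^sup>+t. \<integral>\<^sup>+s. g t s * (if 0 \<le> s \<and> s \<le> t then 1 else 0) \<partial>unit_measure \<partial>unit_measure)
      + (\<integral>\<^sup>+t. \<integral>\<^sup>+s. g t s * (if 0 \<le> t \<and> t \<le> s then 1 else 0) \<partial>unit_measure \<partial>unit_measure)"
    by (intro nn_integral_add) measurable
  also have "(\<integral>\<^sup>+t. \<integral>\<^sup>+s. g t s * (if 0 \<le> t \<and> t \<le> s then 1 else 0) \<partial>unit_measure \<partial>unit_measure)
      = (\<integral>\<^sup>+s. \<integral>\<^sup>+t. g t s * (if 0 \<le> t \<and> t \<le> s then 1 else 0) \<partial>unit_measure \<partial>unit_measure)"
    by (rule unit_pair.Fubini'[symmetric]) measurable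
  also have "(\<integral>\<^sup>+t. \<integral>\<^sup>+s. g t s * (if 0 \<le> s \<and> s \<le> t then 1 else 0) \<partial>unit_measure \<partial>unit_measure)
      + (\<integral>\<^sup>+s. \<integral>\<^sup>+t. g t s * (if 0 \<le> t \<and> t \<le> s then 1 else 0) \<partial>unit_measure \<partial>unit_measure)
    = (\<integral>\<^sup>+t. (\<integral>\<^sup>+s. g t s * (if 0 \<le> s \<and> s \<le> t then 1 else 0) \<partial>unit_measure) + (\<integral>\<^sup>+s. g s t * (if 0 \<le> s \<and> s \<le> t then 1 else 0) \<partial>unit_measure) \<partial>unit_measure)"
    by (intro nn_integral_add[symmetric]) measurable
  also have "\<dots> = (\<integral>\<^sup>+t. ennreal t * (\<integral>\<^sup>+s. g t (t * s) + g (t * s) t \<partial>unit_measure) \<partial>unit_measure)"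
    by (rule nn_integral_cong_AE, use AE_unit_measure in eventually_elim)
      (simp add: sub nn_integral_add distrib_left)
  finally show ?thesis .
qed

text \<open>Write the points as \<open>p + t (e s - p)\<close> and \<open>p + \<tau> (e' \<sigma> - p)\<close>. Where \<open>\<tau> \<le> t\<close>, substituting
  \<open>\<tau> \<rightarrow> t \<tau>\<close> makes the integrand homogeneous of degree 4 in \<open>t\<close> and moves the first point to the edge
  opposite \<open>p\<close>; the integral of \<open>t ^ 4\<close> is the factor \<open>1 / 5\<close>.\<close>

lemma nn_integral_dist_triangles:
  fixes p u v u' v' :: complex
  assumes D: "cross (u - p) (v - p) \<noteq> 0" and D': "cross (u' - p) (v' - p) \<noteq> 0"
  defines "T \<equiv> convex hull {p, u, v}" and "T' \<equiv> convex hull {p, u', v'}"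
  defines "e s \<equiv> (1 - of_real s) * u + of_real s * v" and "e' s \<equiv> (1 - of_real s) * u' + of_real s * v'"
  shows "(\<integral>\<^sup>+x. (\<integral>\<^sup>+y. ennreal (dist x y) * indicator T' y \<partial>lborel) * indicator T x \<partial>lborel) =
    ennreal (1 / 5) *
     (ennreal \<bar>cross (u - p) (v - p)\<bar> * (\<integral>\<^sup>+s. (\<integral>\<^sup>+y. ennreal (dist (e s) y) * indicator T' y \<partial>lborel) \<partial>unit_measure) +
      ennreal \<bar>cross (u' - p) (v' - p)\<bar> * (\<integral>\<^sup>+s. (\<integral>\<^sup>+y. ennreal (dist (e' s) y) * indicator T y \<partial>lborel) \<partial>unit_measure))"
proof -
  define a where "a s = (1 - complex_of_real s) * (u - p) + of_real s * (v - p)" for s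
  define b where "b s = (1 - complex_of_real s) * (u' - p) + of_real s * (v' - p)" for s
  have e: "e s = p + a s" "e' s = p + b s" for s
    by (simp_all add: e_def e'_def a_def b_def algebra_simps)
  define h where "h = ennreal \<bar>cross (u - p) (v - p)\<bar>"
  define h' where "h' = ennreal \<bar>cross (u' - p) (v' - p)\<bar>"
  have [measurable]: "a \<in> borel_measurable borel" "b \<in> borel_measurable borel"
    unfolding a_def b_def by (auto intro!: borel_measurable_continuous_onI continuous_intros)
  have [measurable]: "T \<in> sets borel" "T' \<in> sets borel"
    unfolding T_def T'_def by (auto intro!: borel_closed compact_imp_closed compact_convex_hull)
  have T: "(\<integral>\<^sup>+z. f z * indicator T z \<partial>lborel) = h * (\<integral>\<^sup>+t. ennreal t * (\<integral>\<^sup>+s. f (p + of_real t * a s) \<partial>unit_measure) \<partial>unit_measure)"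
    if "f \<in> borel_measurable borel" for f
    unfolding T_def h_def a_def by (rule nn_integral_triangle[OF that D])
  have T': "(\<integral>\<^sup>+z. f z * indicator T' z \<partial>lborel) = h' * (\<integral>\<^sup>+t. ennreal t * (\<integral>\<^sup>+s. f (p + of_real t * b s) \<partial>unit_measure) \<partial>unit_measure)"
    if "f \<in> borel_measurable borel" for f
    unfolding T'_def h'_def b_def by (rule nn_integral_triangle[OF that D'])
  \<comment> \<open>For fixed directions x and y both halves carry t * (t s) * t: the two Jacobian
    factors and the norm. With the t of the diagonal split this makes t^4.\<close>
  have scale: "(\<integral>\<^sup>+t. \<integral>\<^sup>+\<tau>. ennreal t * (ennreal \<tau> * ennreal (norm (of_real t * x - of_real \<tau> * y))) \<partial>unit_measure \<partial>unit_measure)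
      = ennreal (1 / 5) * ((\<integral>\<^sup>+t. ennreal t * ennreal (norm (x - of_real t * y)) \<partial>unit_measure)
         + (\<integral>\<^sup>+t. ennreal t * ennreal (norm (y - of_real t * x)) \<partial>unit_measure))" (is "?L = _ * (?A + ?B)")
    for x y :: complex
  proof -
    have "?L = (\<integral>\<^sup>+t. ennreal t * (\<integral>\<^sup>+s. ennreal t * (ennreal (t * s) * ennreal (norm (of_real t * x - of_real (t * s) * y))) +
        ennreal (t * s) * (ennreal t * ennreal (norm (of_real (t * s) * x - of_real t * y))) \<partial>unit_measure) \<partial>unit_measure)"
      by (rule nn_integral_unit_square_split) measurable
    also have "\<dots> = (\<integral>\<^sup>+t. ennreal (t ^ 4) * (?A + ?B) \<partial>unit_measure)"
    proof (rule nn_integral_cong_AE, use AE_unit_measure in eventually_elim)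
      case (elim t)
      have "(\<integral>\<^sup>+s. ennreal t * (ennreal (t * s) * ennreal (norm (of_real t * x - of_real (t * s) * y))) +
          ennreal (t * s) * (ennreal t * ennreal (norm (of_real (t * s) * x - of_real t * y))) \<partial>unit_measure)
        = (\<integral>\<^sup>+s. ennreal (t ^ 3) * (ennreal s * ennreal (norm (x - of_real s * y)) + ennreal s * ennreal (norm (y - of_real s * x))) \<partial>unit_measure)"
      proof (rule nn_integral_cong_AE, use AE_unit_measure in eventually_elim)
        case (elim s)
        have "of_real t * x - of_real (t * s) * y = of_real t * (x - of_real s * y)"
          "of_real (t * s) * x - of_real t * y = of_real t * (of_real s * x - y)"
          by (simp_all add: algebra_simps)
        then have "norm (of_real t * x - of_real (t * s) * y) = t * norm (x - of_real s * y)"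
          "norm (of_real (t * s) * x - of_real t * y) = t * norm (y - of_real s * x)"
          using \<open>0 < t \<and> t < 1\<close> by (simp_all add: norm_mult norm_minus_commute)
        then show ?case
          using elim \<open>0 < t \<and> t < 1\<close>
          by (simp add: ennreal_mult'[symmetric] ennreal_plus[symmetric] del: ennreal_plus)
            (simp add: power3_eq_cube algebra_simps)
      qed
      also have "\<dots> = ennreal (t ^ 3) * (?A + ?B)"
        by (subst nn_integral_cmult) (auto simp: nn_integral_add)
      finally show ?case
        using elim by (simp add: mult.assoc[symmetric] ennreal_mult'[symmetric] power_Suc[symmetric] eval_nat_numeral)
    qed
    also have "\<dots> = (\<integral>\<^sup>+t. ennreal (t ^ 4) \<partial>unit_measure) * (?A + ?B)"
      by (rule nn_integral_multc) measurable
    also have "(\<integral>\<^sup>+t. ennreal (t ^ 4) \<partial>unit_measure) = ennreal (1 / 5)"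
      by (subst nn_integral_unit_power) simp
    finally show ?thesis .
  qed
  \<comment> \<open>Moving the radial integrals inside the integrals over the far sides makes
    \<open>scale\<close> applicable to fixed directions.\<close>
  have swap_t: "(\<integral>\<^sup>+t. ennreal t * (\<integral>\<^sup>+s. g t s \<partial>unit_measure) \<partial>unit_measure)
      = (\<integral>\<^sup>+s. \<integral>\<^sup>+t. ennreal t * g t s \<partial>unit_measure \<partial>unit_measure)"
    if [measurable]: "case_prod g \<in> borel_measurable (borel \<Otimes>\<^sub>M borel)" for g
  proof -
    have [measurable]: "g t \<in> borel_measurable borel" for t by measurable
    have "(\<integral>\<^sup>+t. ennreal t * (\<integral>\<^sup>+s. g t s \<partial>unit_measure) \<partial>unit_measure)
      = (\<integral>\<^sup>+t. \<integral>\<^sup>+s. ennreal t * g t s \<partial>unit_measure \<partial>unit_measure)"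
      by (simp add: nn_integral_cmult)
    also have "\<dots> = (\<integral>\<^sup>+s. \<integral>\<^sup>+t. ennreal t * g t s \<partial>unit_measure \<partial>unit_measure)"
      by (rule unit_pair.Fubini'[symmetric]) measurable
    finally show ?thesis .
  qed
  define A where "A = (\<integral>\<^sup>+s. \<integral>\<^sup>+\<sigma>. \<integral>\<^sup>+t. ennreal t * ennreal (norm (a s - of_real t * b \<sigma>)) \<partial>unit_measure \<partial>unit_measure \<partial>unit_measure)"
  define B where "B = (\<integral>\<^sup>+s. \<integral>\<^sup>+\<sigma>. \<integral>\<^sup>+t. ennreal t * ennreal (norm (b s - of_real t * a \<sigma>)) \<partial>unit_measure \<partial>unit_measure \<partial>unit_measure)"
  have R1: "(\<integral>\<^sup>+s. (\<integral>\<^sup>+y. ennreal (dist (e s) y) * indicator T' y \<partial>lborel) \<partial>unit_measure) = h' * A"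
  proof -
    have "(\<integral>\<^sup>+s. (\<integral>\<^sup>+y. ennreal (dist (e s) y) * indicator T' y \<partial>lborel) \<partial>unit_measure)
      = (\<integral>\<^sup>+s. h' * (\<integral>\<^sup>+\<sigma>. \<integral>\<^sup>+t. ennreal t * ennreal (norm (a s - of_real t * b \<sigma>)) \<partial>unit_measure \<partial>unit_measure) \<partial>unit_measure)"
      by (subst T', simp, subst swap_t) (auto simp: e dist_norm)
    then show ?thesis unfolding A_def by (subst nn_integral_cmult[symmetric]) auto
  qed
  have R2: "(\<integral>\<^sup>+s. (\<integral>\<^sup>+y. ennreal (dist (e' s) y) * indicator T y \<partial>lborel) \<partial>unit_measure) = h * B"
  proof -
    have "(\<integral>\<^sup>+s. (\<integral>\<^sup>+y. ennreal (dist (e' s) y) * indicator T y \<partial>lborel) \<partial>unit_measure)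
      = (\<integral>\<^sup>+s. h * (\<integral>\<^sup>+\<sigma>. \<integral>\<^sup>+t. ennreal t * ennreal (norm (b s - of_real t * a \<sigma>)) \<partial>unit_measure \<partial>unit_measure) \<partial>unit_measure)"
      by (subst T, simp, subst swap_t) (auto simp: e dist_norm)
    then show ?thesis unfolding B_def by (subst nn_integral_cmult[symmetric]) auto
  qed
  have "(\<integral>\<^sup>+x. (\<integral>\<^sup>+y. ennreal (dist x y) * indicator T' y \<partial>lborel) * indicator T x \<partial>lborel)
    = h * (\<integral>\<^sup>+t. ennreal t * (\<integral>\<^sup>+s. (\<integral>\<^sup>+y. ennreal (dist (p + of_real t * a s) y) * indicator T' y \<partial>lborel) \<partial>unit_measure) \<partial>unit_measure)"
    by (rule T) measurable
  also have "\<dots> = h * (\<integral>\<^sup>+s. \<integral>\<^sup>+t. ennreal t * (\<integral>\<^sup>+y. ennreal (dist (p + of_real t * a s) y) * indicator T' y \<partial>lborel) \<partial>unit_measure \<partial>unit_measure)"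
    by (subst swap_t) measurable
  also have "(\<integral>\<^sup>+s. \<integral>\<^sup>+t. ennreal t * (\<integral>\<^sup>+y. ennreal (dist (p + of_real t * a s) y) * indicator T' y \<partial>lborel) \<partial>unit_measure \<partial>unit_measure)
    = (\<integral>\<^sup>+s. h' * (\<integral>\<^sup>+\<sigma>. \<integral>\<^sup>+t. \<integral>\<^sup>+\<tau>. ennreal t * (ennreal \<tau> * ennreal (norm (of_real t * a s - of_real \<tau> * b \<sigma>))) \<partial>unit_measure \<partial>unit_measure \<partial>unit_measure) \<partial>unit_measure)"
  proof (rule nn_integral_cong)
    fix s
    have "(\<integral>\<^sup>+t. ennreal t * (\<integral>\<^sup>+y. ennreal (dist (p + of_real t * a s) y) * indicator T' y \<partial>lborel) \<partial>unit_measure)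
      = (\<integral>\<^sup>+t. h' * (ennreal t * (\<integral>\<^sup>+\<sigma>. \<integral>\<^sup>+\<tau>. ennreal \<tau> * ennreal (norm (of_real t * a s - of_real \<tau> * b \<sigma>)) \<partial>unit_measure \<partial>unit_measure)) \<partial>unit_measure)"
      by (subst T', simp, subst swap_t) (auto simp: dist_norm mult_ac)
    also have "\<dots> = h' * (\<integral>\<^sup>+t. ennreal t * (\<integral>\<^sup>+\<sigma>. \<integral>\<^sup>+\<tau>. ennreal \<tau> * ennreal (norm (of_real t * a s - of_real \<tau> * b \<sigma>)) \<partial>unit_measure \<partial>unit_measure) \<partial>unit_measure)"
      by (rule nn_integral_cmult) measurable
    also have "(\<integral>\<^sup>+t. ennreal t * (\<integral>\<^sup>+\<sigma>. \<integral>\<^sup>+\<tau>. ennreal \<tau> * ennreal (norm (of_real t * a s - of_real \<tau> * b \<sigma>)) \<partial>unit_measure \<partial>unit_measure) \<partial>unit_measure)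
      = (\<integral>\<^sup>+\<sigma>. \<integral>\<^sup>+t. \<integral>\<^sup>+\<tau>. ennreal t * (ennreal \<tau> * ennreal (norm (of_real t * a s - of_real \<tau> * b \<sigma>))) \<partial>unit_measure \<partial>unit_measure \<partial>unit_measure)"
      by (subst swap_t) (auto simp: nn_integral_cmult)
    finally show "(\<integral>\<^sup>+t. ennreal t * (\<integral>\<^sup>+y. ennreal (dist (p + of_real t * a s) y) * indicator T' y \<partial>lborel) \<partial>unit_measure)
      = h' * (\<integral>\<^sup>+\<sigma>. \<integral>\<^sup>+t. \<integral>\<^sup>+\<tau>. ennreal t * (ennreal \<tau> * ennreal (norm (of_real t * a s - of_real \<tau> * b \<sigma>))) \<partial>unit_measure \<partial>unit_measure \<partial>unit_measure)" .
  qed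
  also have "\<dots> = h' * (ennreal (1 / 5) * (A + (\<integral>\<^sup>+s. \<integral>\<^sup>+\<sigma>. \<integral>\<^sup>+t. ennreal t * ennreal (norm (b \<sigma> - of_real t * a s)) \<partial>unit_measure \<partial>unit_measure \<partial>unit_measure)))"
    unfolding scale A_def by (simp add: nn_integral_cmult nn_integral_add)
  also have "(\<integral>\<^sup>+s. \<integral>\<^sup>+\<sigma>. \<integral>\<^sup>+t. ennreal t * ennreal (norm (b \<sigma> - of_real t * a s)) \<partial>unit_measure \<partial>unit_measure \<partial>unit_measure) = B"
    unfolding B_def by (rule unit_pair.Fubini') measurable
  finally show ?thesis
    unfolding R1 R2 h_def[symmetric] h'_def[symmetric] by (simp add: algebra_simps)
qed

subsection \<open>Fan triangulations of the regular pentagon\<close>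

text \<open>Cramer's rule expresses the coordinates x and y of z by cross products, so the
  inequalities of \<open>triangle_coordinates_iff\<close> become the three half-plane
  conditions.\<close>

lemma mem_triangle_iff:
  assumes D: "cross (u - p) (v - p) > 0"
  shows "z \<in> convex hull {p, u, v} \<longleftrightarrow>
    0 \<le> cross (u - p) (z - p) \<and> cross (v - p) (z - p) \<le> 0 \<and> 0 \<le> cross (v - u) (z - u)"
proof -
  define X where "X = cross (u - p) (v - p)"
  define y where "y = cross (u - p) (z - p) / X"
  define x where "x = y - cross (v - p) (z - p) / X"
  have X: "X > 0" using D by (simp add: X_def)
  have "X * Re (x * (u - p) + y * (v - u)) = X * Re (z - p)" "X * Im (x * (u - p) + y * (v - u)) = X * Im (z - p)"
    using X by (simp_all add: x_def y_def field_simps)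
      (simp_all add: X_def cross_def algebra_simps)
  then have z: "z = p + of_real x * (u - p) + of_real y * (v - u)"
    using X by (simp add: complex_eq_iff)
  have "X * (1 - x) = cross (v - u) (z - u)"
    using X by (simp add: x_def y_def field_simps) (simp add: X_def cross_def algebra_simps)
  then have 1: "x \<le> 1 \<longleftrightarrow> 0 \<le> cross (v - u) (z - u)"
    using X by (metis diff_ge_0_iff_ge zero_le_mult_iff not_less order_less_imp_le)
  have 2: "0 \<le> y \<longleftrightarrow> 0 \<le> cross (u - p) (z - p)" "y \<le> x \<longleftrightarrow> cross (v - p) (z - p) \<le> 0"
    using X by (auto simp: x_def y_def divide_simps)
  show ?thesis
    using triangle_coordinates_iff[of u p v x y] D 1 2 by (auto simp: z[symmetric])
qed

lemma AE_cross_nonzero: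
  assumes "a \<noteq> 0"
  shows "AE z in lborel. cross a (z - p) \<noteq> 0"
proof -
  have eq: "{z. cross a (z - p) = 0} = {z. (\<i> * a) \<bullet> z = (\<i> * a) \<bullet> p}"
    by (auto simp: cross_def inner_complex_def algebra_simps)
  have "negligible {z. cross a (z - p) = 0}"
    unfolding eq by (rule negligible_hyperplane) (use assms in auto)
  moreover have "closed {z. cross a (z - p) = 0}"
    unfolding eq by (rule closed_hyperplane)
  ultimately have "{z. cross a (z - p) = 0} \<in> null_sets lborel"
    by (auto simp: negligible_iff_null_sets null_sets_completion_iff borel_closed)
  then show ?thesis
    by (rule AE_I') auto
qed

text \<open>Almost every z avoids all lines through p and some \<open>w j\<close>. Then
  \<open>cross (w j - p) (z - p)\<close> is positive for j = 0 and negative for j = m, and a sign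
  change between j and j + 1 means that z lies in the j-th triangle. The hypothesis
  \<open>ord\<close> keeps the fan within a half turn, which rules out a second such
  triangle.\<close>

lemma nn_integral_fan:
  fixes w :: "nat \<Rightarrow> complex"
  assumes P: "convex P" "closed P" "p \<in> P" "\<And>i. i \<le> m \<Longrightarrow> w i \<in> P"
    and m: "0 < m"
    and first: "\<And>z. z \<in> P \<Longrightarrow> 0 \<le> cross (w 0 - p) (z - p)"
    and last: "\<And>z. z \<in> P \<Longrightarrow> cross (w m - p) (z - p) \<le> 0"
    and edge: "\<And>z j. z \<in> P \<Longrightarrow> j < m \<Longrightarrow> 0 \<le> cross (w (Suc j) - w j) (z - w j)"
    and pos: "\<And>j. j < m \<Longrightarrow> 0 < cross (w j - p) (w (Suc j) - p)"
    and ord: "\<And>i k. i \<le> k \<Longrightarrow> k \<le> m \<Longrightarrow> 0 \<le> cross (w i - p) (w k - p)"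
    and [measurable]: "f \<in> borel_measurable borel"
  shows "(\<integral>\<^sup>+z. f z * indicator P z \<partial>lborel) =
    (\<Sum>j<m. \<integral>\<^sup>+z. f z * indicator (convex hull {p, w j, w (Suc j)}) z \<partial>lborel)"
proof -
  define T where "T j = convex hull {p, w j, w (Suc j)}" for j
  have [measurable]: "P \<in> sets borel" "T j \<in> sets borel" for j
    using P unfolding T_def by (auto intro!: borel_closed compact_imp_closed compact_convex_hull)
  have TP: "T j \<subseteq> P" if "j < m" for j
    unfolding T_def by (rule hull_minimal) (use that P in auto)
  have T_iff: "z \<in> T j \<longleftrightarrow> 0 \<le> cross (w j - p) (z - p) \<and> cross (w (Suc j) - p) (z - p) \<le> 0"
    if "j < m" "z \<in> P" for j z
    unfolding T_def mem_triangle_iff[OF pos[OF that(1)]] using edge[OF that(2,1)] by simp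
  have ne: "w j - p \<noteq> 0" if "j \<le> m" for j
  proof (cases j)
    case 0
    then show ?thesis using pos[of 0] m by (auto simp: cross_simps)
  next
    case (Suc i)
    then show ?thesis using pos[of i] that by (auto simp: cross_simps)
  qed
  have "AE z in lborel. \<forall>j\<in>{..m}. cross (w j - p) (z - p) \<noteq> 0"
    by (rule AE_finite_allI) (use AE_cross_nonzero[OF ne] in auto)
  then have "AE z in lborel. f z * indicator P z = (\<Sum>j<m. f z * indicator (T j) z)"
  proof eventually_elim
    case (elim z)
    show ?case
    proof (cases "z \<in> P")
      case False
      then show ?thesis using TP by (auto simp: indicator_def intro!: sum.neutral)
    next
      case z: True
      define c where "c j = cross (w j - p) (z - p)" for j
      have nz: "c j \<noteq> 0" if "j \<le> m" for j using elim that by (simp add: c_def)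
      \<comment> \<open>The first ray that has z on its clockwise side; the triangle containing z
        lies just before it.\<close>
      define k where "k = (LEAST k. c k < 0)"
      have cm: "c m < 0" using last[OF z] nz[of m] by (simp add: c_def)
      then have k: "c k < 0" "k \<le> m" unfolding k_def by (auto intro: LeastI Least_le)
      have "c 0 > 0" using first[OF z] nz[of 0] by (simp add: c_def)
      then obtain j where j: "k = Suc j" using k by (cases k) auto
      have "\<not> c j < 0" using not_less_Least[of j "\<lambda>k. c k < 0"] j by (simp add: k_def)
      then have cj: "c j > 0" using nz[of j] j k by auto
      have jm: "j < m" using j k by simp
      have uniq: "i = l" if "i < m" "l < m" "z \<in> T i" "z \<in> T l" for i l
      proof -
        have "False" if il: "i < l" "l < m" "z \<in> T i" "z \<in> T l" for i l
        proof -
          have c: "c i > 0" "c (Suc i) < 0" "c l > 0"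
            using T_iff[OF _ z, of i] T_iff[OF _ z, of l] il nz[of i] nz[of "Suc i"] nz[of l]
            by (auto simp: c_def less_le)
          \<comment> \<open>The three-term Pluecker relation for four plane vectors. For i < l and z
            in both triangles the left side is positive, whereas the right side is at most
            0.\<close>
          have "c l * cross (w i - p) (w (Suc i) - p)
              = c (Suc i) * cross (w i - p) (w l - p) - c i * cross (w (Suc i) - p) (w l - p)"
            unfolding c_def cross_def by (simp add: algebra_simps)
          moreover have "c (Suc i) * cross (w i - p) (w l - p) \<le> 0"
            using c ord[of i l] il by (intro mult_nonpos_nonneg) auto
          moreover have "c i * cross (w (Suc i) - p) (w l - p) \<ge> 0"
            using c ord[of "Suc i" l] il by (intro mult_nonneg_nonneg) auto
          moreover have "c l * cross (w i - p) (w (Suc i) - p) > 0"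
            using c pos[of i] il by (intro mult_pos_pos) auto
          ultimately show False by linarith
        qed
        from this[of i l] this[of l i] show ?thesis using that by (metis linorder_neqE_nat)
      qed
      have "z \<in> T j" using T_iff[OF jm z] cj k(1) j by (simp add: c_def)
      then have "(\<Sum>i<m. f z * indicator (T i) z) = (\<Sum>i<m. if i = j then f z else 0)"
        using uniq jm by (intro sum.cong refl) (auto simp: indicator_def)
      then show ?thesis using z jm by simp
    qed
  qed
  then have "(\<integral>\<^sup>+z. f z * indicator P z \<partial>lborel) = (\<integral>\<^sup>+z. (\<Sum>j<m. f z * indicator (T j) z) \<partial>lborel)"
    by (rule nn_integral_cong_AE)
  also have "\<dots> = (\<Sum>j<m. \<integral>\<^sup>+z. f z * indicator (T j) z \<partial>lborel)"
    by (rule nn_integral_sum) measurable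
  finally show ?thesis unfolding T_def .
qed

text \<open>In this factorisation by half arcs the orientation of three points of the unit circle
  can be read off from the order of their arguments.\<close>

lemma cross_cis_diff:
  "cross (cis b - cis a) (cis c - cis a) = 4 * sin ((b - a) / 2) * sin ((c - b) / 2) * sin ((c - a) / 2)"
proof -
  define x y where "x = (b - a) / 2" and "y = (c - b) / 2"
  have "cross (cis b - cis a) (cis c - cis a) = sin (c - b) + sin (b - a) - sin (c - a)"
    by (simp add: cross_def sin_diff algebra_simps)
  also have "\<dots> = sin (2 * y) + sin (2 * x) - sin (2 * (x + y))"
    by (simp add: x_def y_def diff_divide_distrib algebra_simps)
  also have "\<dots> = 4 * sin x * sin y * sin (x + y)"
  proof -
    have sc: "(cos x)\<^sup>2 = 1 - (sin x)\<^sup>2" "(cos y)\<^sup>2 = 1 - (sin y)\<^sup>2"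
      by (simp_all add: cos_squared_eq)
    show ?thesis
      unfolding sin_double sin_add cos_add
      using sc by algebra
  qed
  also have "x + y = (c - a) / 2" by (simp add: x_def y_def field_simps)
  finally show ?thesis by (simp add: x_def y_def)
qed

section \<open>The pentagon of circumradius 1: vertices, orientations and side half-planes\<close>

definition pentagon_vertex :: "nat \<Rightarrow> complex" where
  "pentagon_vertex k = cis (2 * pi * real k / 5)"

abbreviation "vtx \<equiv> pentagon_vertex"

definition pentagon :: "complex set" where
  "pentagon = convex hull (vtx ` {..<5})"

text \<open>Vertices are indexed by all naturals with period 5, so that sides and orientations
  across the wrap-around can be stated with increasing indices.\<close>

lemma pentagon_vertex_add_5 [simp]: "vtx (k + 5) = vtx k"
proof -
  have "vtx (k + 5) = cis (2 * pi * real k / 5 + 2 * pi)"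
    unfolding pentagon_vertex_def by (rule arg_cong[of _ _ cis]) (simp add: field_simps)
  then show ?thesis by (simp add: cis.ctr pentagon_vertex_def)
qed

definition orient :: "complex \<Rightarrow> complex \<Rightarrow> complex \<Rightarrow> real" where
  "orient a b c = cross (b - a) (c - a)"

lemma orient_pentagon_vertex:
  assumes "i \<le> j" "j \<le> k"
  shows "orient (vtx i) (vtx j) (vtx k) =
    4 * sin (pi * real (j - i) / 5) * sin (pi * real (k - j) / 5) * sin (pi * real (k - i) / 5)"
proof -
  have *: "(2 * pi * real b / 5 - 2 * pi * real a / 5) / 2 = pi * real (b - a) / 5" if "a \<le> b" for a b
    using that by (simp add: of_nat_diff field_simps)
  show ?thesis
    using assms unfolding orient_def pentagon_vertex_def cross_cis_diff by (subst (1 2 3) *) auto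
qed

text \<open>Within one turn all half arcs lie between 0 and pi, where the sine is
  nonnegative.\<close>

lemma orient_pentagon_vertex_nonneg:
  assumes "i \<le> j" "j \<le> k" "k \<le> i + 5"
  shows "0 \<le> orient (vtx i) (vtx j) (vtx k)"
proof -
  have "0 \<le> sin (pi * real n / 5)" if "n \<le> 5" for n
    using that by (intro sin_ge_zero) auto
  then show ?thesis
    using assms unfolding orient_pentagon_vertex[OF assms(1,2)] by (intro mult_nonneg_nonneg) (auto simp del: of_nat_diff)
qed

lemma orient_pentagon_vertex_pos:
  assumes "i < j" "j < k" "k < i + 5"
  shows "0 < orient (vtx i) (vtx j) (vtx k)"
proof -
  have "0 < sin (pi * real n / 5)" if "0 < n" "n < 5" for n
    using that by (intro sin_gt_zero) auto
  then show ?thesis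
    using assms by (subst orient_pentagon_vertex) (auto simp del: of_nat_diff intro!: mult_pos_pos)
qed

text \<open>A half-plane is convex, so the five vertices decide whether it contains the
  pentagon.\<close>

lemma pentagon_edge:
  assumes "z \<in> pentagon" "j < 5"
  shows "0 \<le> orient (vtx j) (vtx (Suc j)) z"
proof -
  have conv: "convex {z. 0 \<le> orient a b z}" for a b
  proof -
    have eq: "{z. 0 \<le> orient a b z} = {z. (\<i> * (b - a)) \<bullet> z \<ge> (\<i> * (b - a)) \<bullet> a}"
      by (auto simp: orient_def cross_def inner_complex_def algebra_simps)
    show ?thesis unfolding eq by (rule convex_halfspace_ge)
  qed
  have "0 \<le> orient (vtx j) (vtx (Suc j)) (vtx i)" if "i < 5" for i
  proof (cases "i \<le> j")
    case True
    \<comment> \<open>Shifting i by one period puts the three indices in increasing order within one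
      turn.\<close>
    then have "0 \<le> orient (vtx j) (vtx (Suc j)) (vtx (i + 5))"
      using assms(2) by (intro orient_pentagon_vertex_nonneg) auto
    then show ?thesis by simp
  qed (use that in \<open>auto intro!: orient_pentagon_vertex_nonneg\<close>)
  then have "pentagon \<subseteq> {z. 0 \<le> orient (vtx j) (vtx (Suc j)) z}"
    unfolding pentagon_def by (intro hull_minimal conv) auto
  with assms show ?thesis by auto
qed

lemma pentagon_vertex_in: "vtx k \<in> pentagon"
proof -
  have "vtx k = vtx (k mod 5)"
  proof -
    have "vtx (r + 5 * q) = vtx r" for r q
    proof (induction q)
      case (Suc q)
      have "vtx (r + 5 * Suc q) = vtx ((r + 5 * q) + 5)"
        by (rule arg_cong[of _ _ vtx]) simp
      also have "\<dots> = vtx r" using Suc by (simp only: pentagon_vertex_add_5)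
      finally show ?case .
    qed simp
    from this[of "k mod 5" "k div 5"] show ?thesis by simp
  qed
  then show ?thesis unfolding pentagon_def by (metis hull_inc imageI lessThan_iff mod_less_divisor zero_less_numeral)
qed

lemma convex_pentagon: "convex pentagon"
  unfolding pentagon_def by (rule convex_convex_hull)

lemma compact_pentagon: "compact pentagon"
  unfolding pentagon_def by (intro compact_convex_hull finite_imp_compact) simp

lemma pentagon_borel [measurable]: "pentagon \<in> sets borel"
  by (intro borel_closed compact_imp_closed compact_pentagon)

definition edge_point :: "nat \<Rightarrow> real \<Rightarrow> complex" where
  "edge_point j s = (1 - of_real s) * vtx j + of_real s * vtx (Suc j)"

lemma orient_edge_point:
  "orient (edge_point j s) a b = (1 - s) * orient (vtx j) a b + s * orient (vtx (Suc j)) a b"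
  by (simp add: orient_def edge_point_def cross_def algebra_simps)

text \<open>The orientation is affine in its first point. Both end values are nonnegative and at
  most one vanishes: that of \<open>vtx 0\<close> for j = 4 and that of \<open>vtx 1\<close> for j =
  1. Strict inequalities for s are therefore essential.\<close>

lemma orient_edge_point_pos:
  assumes "1 \<le> j" "j \<le> 4" "0 < s" "s < 1"
  shows "0 < orient (edge_point 0 s) (vtx j) (vtx (Suc j))"
proof -
  have "0 \<le> orient (vtx 0) (vtx j) (vtx (Suc j))" "0 \<le> orient (vtx 1) (vtx j) (vtx (Suc j))"
    using assms by (auto intro!: orient_pentagon_vertex_nonneg)
  moreover have "0 < orient (vtx 0) (vtx j) (vtx (Suc j)) \<or> 0 < orient (vtx 1) (vtx j) (vtx (Suc j))"
    using assms by (cases "j = 4") (auto intro!: orient_pentagon_vertex_pos)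
  ultimately show ?thesis
    unfolding orient_edge_point using assms by (auto intro: add_pos_nonneg add_nonneg_pos)
qed

lemma nn_integral_pentagon_vertex_fan:
  assumes [measurable]: "f \<in> borel_measurable borel"
  shows "(\<integral>\<^sup>+z. f z * indicator pentagon z \<partial>lborel) =
    (\<Sum>j\<in>{1,2,3}. \<integral>\<^sup>+z. f z * indicator (convex hull {vtx 0, vtx j, vtx (Suc j)}) z \<partial>lborel)"
proof -
  have "(\<integral>\<^sup>+z. f z * indicator pentagon z \<partial>lborel) =
    (\<Sum>j<3. \<integral>\<^sup>+z. f z * indicator (convex hull {vtx 0, vtx (Suc j), vtx (Suc (Suc j))}) z \<partial>lborel)"
  proof (rule nn_integral_fan[where w = "\<lambda>j. vtx (Suc j)"])
    fix z assume z: "z \<in> pentagon"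
    show "0 \<le> cross (vtx (Suc 0) - vtx 0) (z - vtx 0)"
      using pentagon_edge[OF z, of 0] by (simp add: orient_def)
    \<comment> \<open>The side from \<open>vtx 4\<close> back to \<open>vtx 0\<close> bounds the fan
      at its far end; writing its end as index 0 + 5 brings it under
      \<open>pentagon_vertex_add_5\<close>.\<close>
    have "0 \<le> orient (vtx 4) (vtx (0 + 5)) z"
      using pentagon_edge[OF z, of 4] by simp
    then show "cross (vtx (Suc 3) - vtx 0) (z - vtx 0) \<le> 0"
      unfolding pentagon_vertex_add_5 by (simp add: orient_def cross_def algebra_simps)
    show "0 \<le> cross (vtx (Suc (Suc j)) - vtx (Suc j)) (z - vtx (Suc j))" if "j < 3" for j
      using pentagon_edge[OF z, of "Suc j"] that by (simp add: orient_def)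
  next
    fix j :: nat assume "j < 3"
    then show "0 < cross (vtx (Suc j) - vtx 0) (vtx (Suc (Suc j)) - vtx 0)"
      using orient_pentagon_vertex_pos[of 0 "Suc j" "Suc (Suc j)"] by (simp add: orient_def)
  next
    fix i k :: nat assume "i \<le> k" "k \<le> 3"
    then show "0 \<le> cross (vtx (Suc i) - vtx 0) (vtx (Suc k) - vtx 0)"
      using orient_pentagon_vertex_nonneg[of 0 "Suc i" "Suc k"] by (simp add: orient_def)
  qed (auto intro: convex_pentagon compact_imp_closed compact_pentagon pentagon_vertex_in)
  then show ?thesis
    by (simp add: eval_nat_numeral lessThan_Suc add_ac)
qed

lemma nn_integral_pentagon_edge_fan:
  assumes [measurable]: "f \<in> borel_measurable borel" and s: "0 < s" "s < 1"
  shows "(\<integral>\<^sup>+z. f z * indicator pentagon z \<partial>lborel) =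
    (\<Sum>j\<in>{1,2,3,4}. \<integral>\<^sup>+z. f z * indicator (convex hull {edge_point 0 s, vtx j, vtx (Suc j)}) z \<partial>lborel)"
proof -
  have v5: "vtx 5 = vtx 0" using pentagon_vertex_add_5[of 0] by simp
  have "(\<integral>\<^sup>+z. f z * indicator pentagon z \<partial>lborel) =
    (\<Sum>j<4. \<integral>\<^sup>+z. f z * indicator (convex hull {edge_point 0 s, vtx (Suc j), vtx (Suc (Suc j))}) z \<partial>lborel)"
  proof (rule nn_integral_fan[where w = "\<lambda>j. vtx (Suc j)"])
    show "edge_point 0 s \<in> pentagon"
      using convex_pentagon[unfolded convex_alt] pentagon_vertex_in[of 0] pentagon_vertex_in[of "Suc 0"] s
      unfolding edge_point_def by (auto simp: scaleR_conv_of_real)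
    fix z assume z: "z \<in> pentagon"
    \<comment> \<open>Both outer rays of the fan lie on side 0 itself, in opposite directions, so
      both boundary conditions come from the half-plane of that side.\<close>
    have "cross (vtx (Suc 0) - edge_point 0 s) (z - edge_point 0 s) = (1 - s) * orient (vtx 0) (vtx (Suc 0)) z"
      "cross (vtx 0 - edge_point 0 s) (z - edge_point 0 s) = - s * orient (vtx 0) (vtx (Suc 0)) z"
      by (simp_all add: orient_def edge_point_def cross_def algebra_simps)
    then show "0 \<le> cross (vtx (Suc 0) - edge_point 0 s) (z - edge_point 0 s)"
      "cross (vtx (Suc 4) - edge_point 0 s) (z - edge_point 0 s) \<le> 0"
      using pentagon_edge[OF z, of 0] s by (simp_all add: v5)
    show "0 \<le> cross (vtx (Suc (Suc j)) - vtx (Suc j)) (z - vtx (Suc j))" if "j < 4" for j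
      using pentagon_edge[OF z, of "Suc j"] that by (simp add: orient_def)
  next
    fix j :: nat assume "j < 4"
    then have "0 < orient (edge_point 0 s) (vtx (Suc j)) (vtx (Suc (Suc j)))"
      using s by (intro orient_edge_point_pos) auto
    then show "0 < cross (vtx (Suc j) - edge_point 0 s) (vtx (Suc (Suc j)) - edge_point 0 s)"
      by (simp add: orient_def)
  next
    fix i k :: nat assume "i \<le> k" "k \<le> 4"
    then have "0 \<le> orient (edge_point 0 s) (vtx (Suc i)) (vtx (Suc k))"
      unfolding orient_edge_point using s
      by (intro add_nonneg_nonneg mult_nonneg_nonneg orient_pentagon_vertex_nonneg) auto
    then show "0 \<le> cross (vtx (Suc i) - edge_point 0 s) (vtx (Suc k) - edge_point 0 s)"
      by (simp add: orient_def)
  qed (auto intro: convex_pentagon compact_imp_closed compact_pentagon pentagon_vertex_in)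
  then show ?thesis
    by (simp add: eval_nat_numeral lessThan_Suc add_ac)
qed

subsection \<open>The integral of the third side of a triangle\<close>

text \<open>The law of cosines: u and v are the sides enclosing an angle with cosine c.\<close>

definition third_side :: "real \<Rightarrow> real \<Rightarrow> real \<Rightarrow> real" where
  "third_side c u v = sqrt (u\<^sup>2 + v\<^sup>2 - 2 * c * u * v)"

text \<open>Write N for \<open>third_side c 1 x\<close> and split 1 + x = (x - c) + (1 + c). Since N
  N' = x - c, the first part of (1 + x) N integrates to N^3 / 3; the second is the classical
  primitive of the square root of (x - c)^2 + (1 - c^2).\<close>

definition side_primitive :: "real \<Rightarrow> real \<Rightarrow> real" where
  "side_primitive c x = third_side c 1 x ^ 3 / 3 +
     (1 + c) / 2 * ((x - c) * third_side c 1 x + (1 - c\<^sup>2) * ln (x - c + third_side c 1 x))"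

lemma third_side_measurable [measurable (raw)]:
  assumes [measurable]: "f \<in> borel_measurable M" "g \<in> borel_measurable M"
  shows "(\<lambda>x. third_side c (f x) (g x)) \<in> borel_measurable M"
  unfolding third_side_def by measurable

lemma third_side_scale:
  assumes "0 \<le> t"
  shows "third_side c (t * u) (t * v) = t * third_side c u v"
proof -
  have "(t * u)\<^sup>2 + (t * v)\<^sup>2 - 2 * c * (t * u) * (t * v) = t\<^sup>2 * (u\<^sup>2 + v\<^sup>2 - 2 * c * u * v)"
    by (simp add: algebra_simps power2_eq_square)
  then show ?thesis
    using assms by (simp add: third_side_def real_sqrt_mult)
qed

lemma third_side_swap: "third_side c u v = third_side c v u"
  by (simp add: third_side_def algebra_simps)

text \<open>Completing the square leaves the positive constant 1 - c^2; this keeps the root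
  differentiable and the argument of the logarithm in \<open>side_primitive\<close>
  positive.\<close>

lemma third_side_bounds:
  assumes "\<bar>c\<bar> < 1"
  shows "0 < 1\<^sup>2 + x\<^sup>2 - 2 * c * 1 * x" "\<bar>x - c\<bar> < third_side c 1 x"
proof -
  have c: "c\<^sup>2 < 1" using assms by (simp add: abs_square_less_1)
  have eq: "1\<^sup>2 + x\<^sup>2 - 2 * c * 1 * x = (x - c)\<^sup>2 + (1 - c\<^sup>2)"
    by (simp add: power2_eq_square algebra_simps)
  then show "0 < 1\<^sup>2 + x\<^sup>2 - 2 * c * 1 * x"
    using c by (smt (verit) zero_le_power2)
  have "sqrt ((x - c)\<^sup>2) < third_side c 1 x"
    unfolding third_side_def eq using c by (intro real_sqrt_less_mono) auto
  then show "\<bar>x - c\<bar> < third_side c 1 x" by simp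
qed

lemma side_primitive_deriv:
  assumes "\<bar>c\<bar> < 1"
  shows "(side_primitive c has_real_derivative (1 + x) * third_side c 1 x) (at x)"
proof -
  define N where "N = third_side c 1 x"
  note b = third_side_bounds[OF assms, of x, folded N_def]
  have N2: "N * N = 1 + x * x - 2 * c * x"
    using b(1) unfolding N_def third_side_def by (simp add: power2_eq_square)
  have N: "N > 0" "x - c + N > 0" using b by auto
  have dN: "(third_side c 1 has_real_derivative (x - c) / N) (at x)"
    unfolding third_side_def[abs_def] using b(1)
    by (auto intro!: derivative_eq_intros simp: N_def third_side_def field_simps)
  have "1 + (x - c) / N = (x - c + N) / N"
    using N by (simp add: field_simps)
  \<comment> \<open>The logarithmic term differentiates to 1 / N because 1 + N' is (x - c + N) /
    N.\<close>
  then have L: "(1 + (x - c) / N) / (x - c + N) = 1 / N"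
    using N by simp
  have "(side_primitive c has_real_derivative
      (3 * N\<^sup>2 * ((x - c) / N)) / 3 + (1 + c) / 2 *
        ((N + (x - c) * ((x - c) / N)) + (1 - c\<^sup>2) * ((1 + (x - c) / N) / (x - c + N)))) (at x)"
    unfolding side_primitive_def[abs_def] using N
    by (auto intro!: derivative_eq_intros dN simp: N_def[symmetric] mult_ac)
  also have "(3 * N\<^sup>2 * ((x - c) / N)) / 3 + (1 + c) / 2 *
        ((N + (x - c) * ((x - c) / N)) + (1 - c\<^sup>2) * ((1 + (x - c) / N) / (x - c + N))) = (1 + x) * N"
  proof -
    \<comment> \<open>Multiplying by N clears the denominators, and N * N is a polynomial in
      x.\<close>
    have "N * ((3 * N\<^sup>2 * ((x - c) / N)) / 3 + (1 + c) / 2 *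
        ((N + (x - c) * ((x - c) / N)) + (1 - c\<^sup>2) * ((1 + (x - c) / N) / (x - c + N))))
      = (N * N) * (x - c) + (1 + c) / 2 * (N * N + (x - c) * (x - c) + (1 - c * c))"
      unfolding L using N(1) by (simp add: field_simps power2_eq_square)
    also have "\<dots> = (x - c) * (N * N) + (1 + c) * (N * N)"
      unfolding N2 by (simp add: field_simps)
    also have "\<dots> = N * ((1 + x) * N)" by (simp add: algebra_simps)
    finally show ?thesis using N(1) by simp
  qed
  finally show ?thesis unfolding N_def .
qed

section \<open>Double integrals of the third side over squares\<close>

lemma nn_integral_unit_affine:
  assumes [measurable]: "f \<in> borel_measurable borel" and a: "0 \<le> a" "a < (1::real)"
  shows "(\<integral>\<^sup>+x. f (a + (1 - a) * x) \<partial>unit_measure) =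
    ennreal (1 / (1 - a)) * (\<integral>\<^sup>+x. f x * indicator {a..} x \<partial>unit_measure)"
proof -
  have "(\<integral>\<^sup>+x. f x * indicator {a..} x \<partial>unit_measure) = (\<integral>\<^sup>+x. f x * indicator {a..1} x \<partial>lborel)"
    using a by (subst nn_integral_unit_measure) (auto intro!: nn_integral_cong simp: indicator_def)
  also have "\<dots> = ennreal \<bar>1 - a\<bar> * (\<integral>\<^sup>+x. f (a + (1 - a) * x) * indicator {a..1} (a + (1 - a) * x) \<partial>lborel)"
    using a by (intro nn_integral_real_affine) auto
  also have "(\<integral>\<^sup>+x. f (a + (1 - a) * x) * indicator {a..1} (a + (1 - a) * x) \<partial>lborel)
      = (\<integral>\<^sup>+x. f (a + (1 - a) * x) \<partial>unit_measure)"
  proof (subst nn_integral_unit_measure)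
    have "a + (1 - a) * x \<in> {a..1} \<longleftrightarrow> x \<in> {0..1}" for x
    proof -
      have "1 - (a + (1 - a) * x) = (1 - a) * (1 - x)" by algebra
      then have "a + (1 - a) * x \<le> 1 \<longleftrightarrow> 0 \<le> (1 - a) * (1 - x)" by linarith
      then show ?thesis using a by (auto simp: zero_le_mult_iff)
    qed
    then show "(\<integral>\<^sup>+x. f (a + (1 - a) * x) * indicator {a..1} (a + (1 - a) * x) \<partial>lborel) =
        (\<integral>\<^sup>+x. f (a + (1 - a) * x) * indicator {0..1} x \<partial>lborel)"
      by (intro nn_integral_cong) (auto simp: indicator_def)
  qed measurable
  finally show ?thesis
    using a by (simp add: mult.assoc[symmetric] ennreal_mult'[symmetric])
qed

lemma nn_integral_unit_reflect:
  assumes [measurable]: "f \<in> borel_measurable borel"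
  shows "(\<integral>\<^sup>+x. f (1 - x) \<partial>unit_measure) = (\<integral>\<^sup>+x. f x \<partial>unit_measure)"
proof -
  have "(\<integral>\<^sup>+x. f x \<partial>unit_measure) = (\<integral>\<^sup>+x. f x * indicator {0..1} x \<partial>lborel)"
    by (rule nn_integral_unit_measure) measurable
  also have "\<dots> = ennreal \<bar>-1\<bar> * (\<integral>\<^sup>+x. f (1 + (-1) * x) * indicator {0..1} (1 + (-1) * x) \<partial>lborel)"
    by (intro nn_integral_real_affine) auto
  also have "(\<integral>\<^sup>+x. f (1 + (-1) * x) * indicator {0..1} (1 + (-1) * x) \<partial>lborel)
      = (\<integral>\<^sup>+x. f (1 - x) \<partial>unit_measure)"
    by (subst nn_integral_unit_measure) (auto intro!: nn_integral_cong simp: indicator_def)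
  finally show ?thesis by simp
qed

text \<open>Let t be the larger variable and s the ratio. The factors u of the two halves, t and t
  s, add up to t (1 + s), and \<open>third_side\<close> contributes t, so the integrand separates
  into (1 + s) \<open>third_side c 1 s\<close> and t^3 (with the Jacobian). On the right-hand side
  the bound variable is the ratio.\<close>

lemma nn_integral_third_side_homogeneous:
  assumes a: "0 \<le> a" "a < 1"
  shows "(\<integral>\<^sup>+u. \<integral>\<^sup>+v. ennreal (u * third_side c u v) * indicator {a..} u * indicator {a..} v \<partial>unit_measure \<partial>unit_measure)
    = (\<integral>\<^sup>+t. ennreal ((1 + t) * third_side c 1 t) * (ennreal ((1 - (a / t) ^ 4) / 4) * indicator {a..} t) \<partial>unit_measure)"
proof -
  \<comment> \<open>For a fixed ratio s the smaller variable t s must reach a, so t runs from a / s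
    to 1, which is empty for s < a.\<close>
  have inner: "(\<integral>\<^sup>+t. ennreal (t ^ 3) * indicator {a..} (t * s) \<partial>unit_measure) = ennreal ((1 - (a / s) ^ 4) / 4) * indicator {a..} s"
    if s: "0 < s" "s < 1" for s
  proof (cases "a \<le> s")
    case True
    have "(\<integral>\<^sup>+t. ennreal (t ^ 3) * indicator {a..} (t * s) \<partial>unit_measure) = (\<integral>\<^sup>+t. ennreal (t ^ 3) * indicator {a / s..1} t \<partial>lborel)"
      using a s by (subst nn_integral_unit_measure)
        (auto intro!: nn_integral_cong simp: indicator_def pos_divide_le_eq, meson divide_nonneg_pos order_trans pos_divide_le_eq)
    also have "\<dots> = ennreal (1 ^ 4 / 4 - (a / s) ^ 4 / 4)"
    proof (rule nn_integral_FTC_Icc)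
      fix t assume "t \<in> {a / s..1}"
      then have "0 \<le> t"
        using a s by (meson atLeastAtMost_iff divide_nonneg_pos order_trans)
      then show "0 \<le> t ^ 3" by simp
      show "((\<lambda>t. t ^ 4 / 4) has_real_derivative t ^ 3) (at t)"
        by (auto intro!: derivative_eq_intros)
    qed (use True s in auto)
    finally show ?thesis using True by (simp add: diff_divide_distrib)
  next
    case False
    have "(\<integral>\<^sup>+t. ennreal (t ^ 3) * indicator {a..} (t * s) \<partial>unit_measure) = (\<integral>\<^sup>+t. 0 \<partial>unit_measure)"
    proof (rule nn_integral_cong_AE, use AE_unit_measure in eventually_elim)
      case (elim t)
      then have "t * s \<le> 1 * s" using s by (intro mult_right_mono) auto
      then show ?case using False by (auto simp: indicator_def)
    qed
    then show ?thesis using False by simp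
  qed
  have "(\<integral>\<^sup>+u. \<integral>\<^sup>+v. ennreal (u * third_side c u v) * indicator {a..} u * indicator {a..} v \<partial>unit_measure \<partial>unit_measure)
    = (\<integral>\<^sup>+t. ennreal t * (\<integral>\<^sup>+s. ennreal (t * third_side c t (t * s)) * indicator {a..} t * indicator {a..} (t * s) +
        ennreal (t * s * third_side c (t * s) t) * indicator {a..} (t * s) * indicator {a..} t \<partial>unit_measure) \<partial>unit_measure)"
    by (rule nn_integral_unit_square_split) measurable
  also have "\<dots> = (\<integral>\<^sup>+t. \<integral>\<^sup>+s. ennreal t * (ennreal (t * third_side c t (t * s)) * indicator {a..} t * indicator {a..} (t * s) +
        ennreal (t * s * third_side c (t * s) t) * indicator {a..} (t * s) * indicator {a..} t) \<partial>unit_measure \<partial>unit_measure)"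
    by (intro nn_integral_cong nn_integral_cmult[symmetric]) measurable
  also have "\<dots> = (\<integral>\<^sup>+t. \<integral>\<^sup>+s. ennreal ((1 + s) * third_side c 1 s) * (ennreal (t ^ 3) * indicator {a..} (t * s)) \<partial>unit_measure \<partial>unit_measure)"
  proof (rule nn_integral_cong_AE, use AE_unit_measure in eventually_elim)
    fix t :: real assume t: "0 < t \<and> t < 1"
    show "(\<integral>\<^sup>+s. ennreal t * (ennreal (t * third_side c t (t * s)) * indicator {a..} t * indicator {a..} (t * s) +
        ennreal (t * s * third_side c (t * s) t) * indicator {a..} (t * s) * indicator {a..} t) \<partial>unit_measure)
      = (\<integral>\<^sup>+s. ennreal ((1 + s) * third_side c 1 s) * (ennreal (t ^ 3) * indicator {a..} (t * s)) \<partial>unit_measure)"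
    proof (rule nn_integral_cong_AE, use AE_unit_measure in eventually_elim)
      fix s :: real assume s: "0 < s \<and> s < 1"
      have k: "third_side c (t * s) t = t * third_side c 1 s" "third_side c t (t * s) = t * third_side c 1 s"
        using third_side_scale[of t c 1 s] t by (simp_all add: third_side_swap[of c "t * s"])
      show "ennreal t * (ennreal (t * third_side c t (t * s)) * indicator {a..} t * indicator {a..} (t * s) +
          ennreal (t * s * third_side c (t * s) t) * indicator {a..} (t * s) * indicator {a..} t) =
        ennreal ((1 + s) * third_side c 1 s) * (ennreal (t ^ 3) * indicator {a..} (t * s))"
      proof (cases "a \<le> t * s")
        case True
        have "t * s \<le> t * 1" using s t by (intro mult_left_mono) auto
        with True have "a \<le> t" by simp
        show ?thesis
        proof (cases "0 \<le> third_side c 1 s")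
          case pos: True
          show ?thesis
            using True \<open>a \<le> t\<close> s t pos unfolding k
            by (simp add: ennreal_mult'[symmetric] ennreal_plus[symmetric] del: ennreal_plus)
              (simp add: power3_eq_cube algebra_simps)
        next
          \<comment> \<open>As c is arbitrary, the radicand can be negative; \<open>sqrt\<close> is
            then negative and \<open>ennreal\<close> truncates both sides to 0.\<close>
          case neg: False
          have 1: "t * (t * third_side c 1 s) \<le> 0" "t * s * (t * third_side c 1 s) \<le> 0"
            "(1 + s) * third_side c 1 s \<le> 0"
            using s t neg by (auto intro!: mult_nonneg_nonpos)
          show ?thesis unfolding k using 1 by (simp only: ennreal_neg) simp
        qed
      qed (simp add: indicator_def)
    qed
  qed
  also have "\<dots> = (\<integral>\<^sup>+s. \<integral>\<^sup>+t. ennreal ((1 + s) * third_side c 1 s) * (ennreal (t ^ 3) * indicator {a..} (t * s)) \<partial>unit_measure \<partial>unit_measure)"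
    by (rule unit_pair.Fubini'[symmetric]) measurable
  also have "\<dots> = (\<integral>\<^sup>+s. ennreal ((1 + s) * third_side c 1 s) * (\<integral>\<^sup>+t. ennreal (t ^ 3) * indicator {a..} (t * s) \<partial>unit_measure) \<partial>unit_measure)"
    by (intro nn_integral_cong nn_integral_cmult) measurable
  also have "\<dots> = (\<integral>\<^sup>+t. ennreal ((1 + t) * third_side c 1 t) * (ennreal ((1 - (a / t) ^ 4) / 4) * indicator {a..} t) \<partial>unit_measure)"
    by (rule nn_integral_cong_AE, use AE_unit_measure in eventually_elim) (simp add: inner)
  finally show ?thesis .
qed

lemma nn_integral_third_side_unit_square:
  assumes c: "\<bar>c\<bar> < 1"
  shows "(\<integral>\<^sup>+u. \<integral>\<^sup>+v. ennreal (u * third_side c u v) \<partial>unit_measure \<partial>unit_measure)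
    = ennreal ((side_primitive c 1 - side_primitive c 0) / 4)"
proof -
  have pos: "0 < third_side c 1 x" for x using third_side_bounds[OF c, of x] by linarith
  have "(\<integral>\<^sup>+u. \<integral>\<^sup>+v. ennreal (u * third_side c u v) \<partial>unit_measure \<partial>unit_measure)
    = (\<integral>\<^sup>+u. \<integral>\<^sup>+v. ennreal (u * third_side c u v) * indicator {0..} u * indicator {0..} v \<partial>unit_measure \<partial>unit_measure)"
  proof (rule nn_integral_cong_AE, use AE_unit_measure in eventually_elim)
    fix u :: real assume u: "0 < u \<and> u < 1"
    show "(\<integral>\<^sup>+v. ennreal (u * third_side c u v) \<partial>unit_measure) = (\<integral>\<^sup>+v. ennreal (u * third_side c u v) * indicator {0..} u * indicator {0..} v \<partial>unit_measure)"
      by (rule nn_integral_cong_AE, use AE_unit_measure in eventually_elim) (use u in simp)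
  qed
  also have "\<dots> = (\<integral>\<^sup>+t. ennreal ((1 + t) * third_side c 1 t) * (ennreal ((1 - (0 / t) ^ 4) / 4) * indicator {0..} t) \<partial>unit_measure)"
    by (rule nn_integral_third_side_homogeneous) auto
  also have "\<dots> = (\<integral>\<^sup>+t. ennreal ((1 + t) * third_side c 1 t / 4) \<partial>unit_measure)"
    by (rule nn_integral_cong_AE, use AE_unit_measure in eventually_elim)
      (simp add: ennreal_mult'[symmetric] pos less_imp_le)
  also have "\<dots> = ennreal (side_primitive c 1 / 4 - side_primitive c 0 / 4)"
    by (rule nn_integral_unit_FTC[where F = "\<lambda>x. side_primitive c x / 4"])
      (auto intro!: derivative_eq_intros side_primitive_deriv c less_imp_le[OF pos] mult_nonneg_nonneg)
  finally show ?thesis by (simp add: diff_divide_distrib)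
qed

text \<open>Both variables are moved to [a, 1], whence the denominator (1 - a)^2. Nonnegativity is a
  separate claim because an equation between \<open>ennreal\<close> values does not reveal it:
  negative reals are truncated to 0.\<close>

lemma nn_integral_third_side_shifted_square:
  assumes c: "\<bar>c\<bar> < 1" and a: "0 < a" "a < 1"
  shows "0 \<le> ((1 + a ^ 4) * side_primitive c 1 - side_primitive c a - a ^ 4 * side_primitive c (1 / a)) / (4 * (1 - a)\<^sup>2)"
    (is ?nonneg)
  and "(\<integral>\<^sup>+u. \<integral>\<^sup>+v. ennreal ((a + (1 - a) * u) * third_side c (a + (1 - a) * u) (a + (1 - a) * v)) \<partial>unit_measure \<partial>unit_measure)
    = ennreal (((1 + a ^ 4) * side_primitive c 1 - side_primitive c a - a ^ 4 * side_primitive c (1 / a)) / (4 * (1 - a)\<^sup>2))" (is ?integral)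
proof -
  have pos: "0 < third_side c 1 x" for x using third_side_bounds[OF c, of x] by linarith
  \<comment> \<open>\<open>third_side c 1 (1 / t) = third_side c 1 t / t\<close>, so \<open>- side_primitive c (1 / t)\<close> has derivative
    \<open>(1 + t) / t ^ 4 * third_side c 1 t\<close>.\<close>
  define F where "F t = (side_primitive c t + a ^ 4 * side_primitive c (1 / t)) / 4" for t
  have deriv: "(F has_real_derivative (1 + t) * third_side c 1 t * (1 - (a / t) ^ 4) / 4) (at t)"
    if "a \<le> t" for t
  proof -
    have t0: "0 < t" using that a by simp
    have "third_side c 1 (1 / t) = third_side c 1 t / t"
      using third_side_scale[of "1 / t" c t 1] t0 by (simp add: third_side_swap[of c t])
    then have "(F has_real_derivative ((1 + t) * third_side c 1 t + a ^ 4 * ((1 + 1 / t) * (third_side c 1 t / t) * (- (1 / t\<^sup>2)))) / 4) (at t)"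
      unfolding F_def[abs_def] using t0
      by (auto intro!: derivative_eq_intros side_primitive_deriv[OF c] DERIV_chain2[OF side_primitive_deriv[OF c]] simp: power2_eq_square)
    also have "((1 + t) * third_side c 1 t + a ^ 4 * ((1 + 1 / t) * (third_side c 1 t / t) * (- (1 / t\<^sup>2)))) / 4
        = (1 + t) * third_side c 1 t * (1 - (a / t) ^ 4) / 4"
      using t0 by (simp add: field_simps eval_nat_numeral)
    finally show ?thesis .
  qed
  have nonneg: "0 \<le> (1 + t) * third_side c 1 t * (1 - (a / t) ^ 4) / 4" if t: "a \<le> t" for t
  proof -
    have t0: "0 < t" using that a by simp
    have "(a / t) ^ 4 \<le> 1" using t t0 a by (intro power_le_one) auto
    then show ?thesis
      using t0 pos[of t] by (intro mult_nonneg_nonneg divide_nonneg_nonneg) auto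
  qed
  have "F a \<le> F 1"
    by (rule DERIV_nonneg_imp_nondecreasing[where f = F]) (use a deriv nonneg in \<open>auto intro!: exI\<close>)
  have F_diff: "(1 / (1 - a)) * ((1 / (1 - a)) * (F 1 - F a)) = ((1 + a ^ 4) * side_primitive c 1 - side_primitive c a - a ^ 4 * side_primitive c (1 / a)) / (4 * (1 - a)\<^sup>2)"
  proof -
    have "F 1 - F a = ((1 + a ^ 4) * side_primitive c 1 - side_primitive c a - a ^ 4 * side_primitive c (1 / a)) / 4"
      by (simp add: F_def field_simps)
    then show ?thesis by (simp only: power2_eq_square) simp
  qed
  show ?nonneg
    unfolding F_diff[symmetric] using a \<open>F a \<le> F 1\<close> by simp
  have "(\<integral>\<^sup>+u. \<integral>\<^sup>+v. ennreal ((a + (1 - a) * u) * third_side c (a + (1 - a) * u) (a + (1 - a) * v)) \<partial>unit_measure \<partial>unit_measure)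
    = (\<integral>\<^sup>+u. ennreal (1 / (1 - a)) * (\<integral>\<^sup>+v. ennreal ((a + (1 - a) * u) * third_side c (a + (1 - a) * u) v) * indicator {a..} v \<partial>unit_measure) \<partial>unit_measure)"
    by (intro nn_integral_cong nn_integral_unit_affine) (use a in auto)
  also have "\<dots> = ennreal (1 / (1 - a)) * (\<integral>\<^sup>+u. \<integral>\<^sup>+v. ennreal ((a + (1 - a) * u) * third_side c (a + (1 - a) * u) v) * indicator {a..} v \<partial>unit_measure \<partial>unit_measure)"
    by (rule nn_integral_cmult) measurable
  also have "(\<integral>\<^sup>+u. \<integral>\<^sup>+v. ennreal ((a + (1 - a) * u) * third_side c (a + (1 - a) * u) v) * indicator {a..} v \<partial>unit_measure \<partial>unit_measure)
    = ennreal (1 / (1 - a)) * (\<integral>\<^sup>+u. (\<integral>\<^sup>+v. ennreal (u * third_side c u v) * indicator {a..} v \<partial>unit_measure) * indicator {a..} u \<partial>unit_measure)"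
    by (rule nn_integral_unit_affine) (use a in auto)
  also have "(\<integral>\<^sup>+u. (\<integral>\<^sup>+v. ennreal (u * third_side c u v) * indicator {a..} v \<partial>unit_measure) * indicator {a..} u \<partial>unit_measure)
    = (\<integral>\<^sup>+u. \<integral>\<^sup>+v. ennreal (u * third_side c u v) * indicator {a..} u * indicator {a..} v \<partial>unit_measure \<partial>unit_measure)"
    by (intro nn_integral_cong) (subst nn_integral_multc[symmetric]; simp add: mult_ac)
  also have "\<dots> = (\<integral>\<^sup>+t. ennreal ((1 + t) * third_side c 1 t) * (ennreal ((1 - (a / t) ^ 4) / 4) * indicator {a..} t) \<partial>unit_measure)"
    by (rule nn_integral_third_side_homogeneous) (use a in auto)
  also have "\<dots> = (\<integral>\<^sup>+t. ennreal ((1 + t) * third_side c 1 t * (1 - (a / t) ^ 4) / 4) * indicator {a..1} t \<partial>lborel)"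
    using a pos by (subst nn_integral_unit_measure)
      (auto intro!: nn_integral_cong simp: indicator_def ennreal_mult'[symmetric] less_imp_le)
  also have "\<dots> = ennreal (F 1 - F a)"
    by (rule nn_integral_FTC_Icc) (use deriv nonneg a in auto)
  also have "ennreal (1 / (1 - a)) * (ennreal (1 / (1 - a)) * ennreal (F 1 - F a))
      = ennreal ((1 / (1 - a)) * ((1 / (1 - a)) * (F 1 - F a)))"
    using a by (simp add: ennreal_mult'[symmetric])
  finally show ?integral unfolding F_diff .
qed

subsection \<open>Reduction to pairs of sides\<close>

definition distance_potential :: "complex \<Rightarrow> ennreal" where
  "distance_potential z = (\<integral>\<^sup>+y. ennreal (dist z y) * indicator pentagon y \<partial>lborel)"

lemma distance_potential_measurable [measurable]: "distance_potential \<in> borel_measurable borel"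
  unfolding distance_potential_def[abs_def] by measurable

lemma edge_point_measurable [measurable]: "edge_point j \<in> borel_measurable borel"
  unfolding edge_point_def[abs_def] by (auto intro!: borel_measurable_continuous_onI continuous_intros)

lemma pentagon_vertex_mult: "vtx j * vtx k = vtx (j + k)"
  unfolding pentagon_vertex_def cis_mult by (rule arg_cong[of _ _ cis]) (simp add: field_simps)

text \<open>Multiplication by \<open>vtx j\<close> rotates the vertices among themselves and hence
  maps the hull into itself; the inverse rotation does so too.\<close>

lemma pentagon_vertex_mult_in_iff: "vtx j * z \<in> pentagon \<longleftrightarrow> z \<in> pentagon"
proof -
  have *: "vtx j * z \<in> pentagon" if "z \<in> pentagon" for j z
  proof -
    have "convex ((\<lambda>z. vtx j * z) -` pentagon)"
      by (intro convex_linear_vimage convex_pentagon linear_times)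
    then have "pentagon \<subseteq> (\<lambda>z. vtx j * z) -` pentagon"
      unfolding pentagon_def by (intro hull_minimal) (auto simp: pentagon_def[symmetric] pentagon_vertex_mult pentagon_vertex_in)
    with that show ?thesis by auto
  qed
  \<comment> \<open>The inverse rotation has index 4 j, since index 5 j is j full turns.\<close>
  have "vtx (4 * j) * (vtx j * z) = z"
  proof -
    have "vtx (4 * j) * vtx j = cis (2 * pi * real j)"
      unfolding pentagon_vertex_def cis_mult by (rule arg_cong[of _ _ cis]) (simp add: field_simps)
    also have "\<dots> = 1" by (metis cis_multiple_2pi Ints_of_nat of_int_of_nat_eq)
    finally show ?thesis by (simp add: mult.assoc[symmetric])
  qed
  then show ?thesis using *[of z j] *[of "vtx j * z" "4 * j"] by (simp only:) blast
qed

lemma norm_pentagon_vertex [simp]: "norm (vtx j) = 1"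
  by (simp add: pentagon_vertex_def)

lemma distance_potential_rotate: "distance_potential (vtx j * z) = distance_potential z"
proof -
  have "vtx j \<noteq> 0" using norm_pentagon_vertex[of j] by (metis norm_zero zero_neq_one)
  then have "distance_potential (vtx j * z) = ennreal ((norm (vtx j))\<^sup>2) *
      (\<integral>\<^sup>+y. ennreal (dist (vtx j * z) (0 + vtx j * y)) * indicator pentagon (0 + vtx j * y) \<partial>lborel)"
    unfolding distance_potential_def by (intro nn_integral_similarity) auto
  also have "\<dots> = distance_potential z"
    by (simp add: distance_potential_def indicator_def pentagon_vertex_mult_in_iff dist_norm
        norm_mult right_diff_distrib[symmetric])
  finally show ?thesis .
qed

lemma distance_potential_edge_point: "distance_potential (edge_point j s) = distance_potential (edge_point 0 s)"
proof -
  have "edge_point j s = vtx j * edge_point 0 s"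
    unfolding edge_point_def distrib_left mult.left_commute[of "vtx j"] pentagon_vertex_mult by simp
  then show ?thesis by (simp only: distance_potential_rotate)
qed

text \<open>\<open>nn_integral_dist_triangles\<close> is applied to all ordered pairs of fan
  triangles, equal ones included. Summation over the second triangle reassembles the potential on
  the far side of the first, and by rotation this side can be replaced by side 0.\<close>

lemma nn_integral_pentagon_distance:
  "(\<integral>\<^sup>+x. distance_potential x * indicator pentagon x \<partial>lborel) =
    ennreal (2 / 5 * (\<Sum>j\<in>{1,2,3}. orient (vtx 0) (vtx j) (vtx (Suc j)))) *
    (\<integral>\<^sup>+s. distance_potential (edge_point 0 s) \<partial>unit_measure)"
proof -
  define J :: "nat set" where "J = {1,2,3}"
  define T where "T j = convex hull {vtx 0, vtx j, vtx (Suc j)}" for j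
  define h where "h j = orient (vtx 0) (vtx j) (vtx (Suc j))" for j
  define G where "G j z = (\<integral>\<^sup>+y. ennreal (dist z y) * indicator (T j) y \<partial>lborel)" for j z
  have h: "h j > 0" if "j \<in> J" for j
    unfolding h_def by (rule orient_pentagon_vertex_pos) (use that in \<open>auto simp: J_def\<close>)
  have [measurable]: "T j \<in> sets borel" for j
    unfolding T_def by (auto intro!: borel_closed compact_imp_closed compact_convex_hull)
  have [measurable]: "G j \<in> borel_measurable borel" for j
    unfolding G_def by measurable
  have fan: "(\<integral>\<^sup>+z. f z * indicator pentagon z \<partial>lborel) = (\<Sum>j\<in>J. \<integral>\<^sup>+z. f z * indicator (T j) z \<partial>lborel)"
    if "f \<in> borel_measurable borel" for f
    unfolding J_def T_def by (rule nn_integral_pentagon_vertex_fan[OF that])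
  have pot: "distance_potential z = (\<Sum>j\<in>J. G j z)" for z
    unfolding distance_potential_def G_def by (rule fan) measurable
  have pair: "(\<integral>\<^sup>+x. G j x * indicator (T i) x \<partial>lborel) = ennreal (1 / 5) *
      (ennreal (h i) * (\<integral>\<^sup>+s. G j (edge_point i s) \<partial>unit_measure) + ennreal (h j) * (\<integral>\<^sup>+s. G i (edge_point j s) \<partial>unit_measure))"
    if "i \<in> J" "j \<in> J" for i j
    using h[OF that(1)] h[OF that(2)]
      nn_integral_dist_triangles[of "vtx i" "vtx 0" "vtx (Suc i)" "vtx j" "vtx (Suc j)"]
    by (simp add: G_def T_def edge_point_def h_def orient_def)
  have "(\<integral>\<^sup>+x. distance_potential x * indicator pentagon x \<partial>lborel)
      = (\<Sum>i\<in>J. \<integral>\<^sup>+x. distance_potential x * indicator (T i) x \<partial>lborel)"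
    by (rule fan) measurable
  also have "\<dots> = (\<Sum>i\<in>J. \<Sum>j\<in>J. \<integral>\<^sup>+x. G j x * indicator (T i) x \<partial>lborel)"
    unfolding pot sum_distrib_right by (intro sum.cong refl nn_integral_sum) measurable
  also have "\<dots> = (\<Sum>i\<in>J. \<Sum>j\<in>J. ennreal (1 / 5) *
      (ennreal (h i) * (\<integral>\<^sup>+s. G j (edge_point i s) \<partial>unit_measure) + ennreal (h j) * (\<integral>\<^sup>+s. G i (edge_point j s) \<partial>unit_measure)))"
    by (intro sum.cong refl pair)
  also have "\<dots> = ennreal (1 / 5) * ((\<Sum>i\<in>J. \<Sum>j\<in>J. ennreal (h i) * (\<integral>\<^sup>+s. G j (edge_point i s) \<partial>unit_measure))
      + (\<Sum>i\<in>J. \<Sum>j\<in>J. ennreal (h j) * (\<integral>\<^sup>+s. G i (edge_point j s) \<partial>unit_measure)))"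
    unfolding sum_distrib_left[symmetric] sum.distrib ..
  \<comment> \<open>Renaming i and j identifies the two halves of the symmetric sum; this doubles
    the factor 1 / 5.\<close>
  also have "(\<Sum>i\<in>J. \<Sum>j\<in>J. ennreal (h j) * (\<integral>\<^sup>+s. G i (edge_point j s) \<partial>unit_measure))
      = (\<Sum>i\<in>J. \<Sum>j\<in>J. ennreal (h i) * (\<integral>\<^sup>+s. G j (edge_point i s) \<partial>unit_measure))"
    by (rule sum.swap)
  also have "(\<Sum>i\<in>J. \<Sum>j\<in>J. ennreal (h i) * (\<integral>\<^sup>+s. G j (edge_point i s) \<partial>unit_measure))
      = (\<Sum>i\<in>J. ennreal (h i) * (\<integral>\<^sup>+s. distance_potential (edge_point i s) \<partial>unit_measure))"
    unfolding pot sum_distrib_left[symmetric] by (intro sum.cong refl arg_cong2[of _ _ _ _ "(*)"] nn_integral_sum[symmetric]) measurable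
  also have "\<dots> = (\<Sum>i\<in>J. ennreal (h i)) * (\<integral>\<^sup>+s. distance_potential (edge_point 0 s) \<partial>unit_measure)"
    by (simp only: sum_distrib_right) (intro sum.cong refl arg_cong2[of _ _ _ _ "(*)"] nn_integral_cong distance_potential_edge_point)
  also have "(\<Sum>i\<in>J. ennreal (h i)) = ennreal (\<Sum>i\<in>J. h i)"
    using h by (intro sum_ennreal) (auto intro: less_imp_le)
  finally have "(\<integral>\<^sup>+x. distance_potential x * indicator pentagon x \<partial>lborel)
    = (ennreal (1 / 5) * (2 * ennreal (\<Sum>i\<in>J. h i))) * (\<integral>\<^sup>+s. distance_potential (edge_point 0 s) \<partial>unit_measure)"
    by (simp only: mult_2[symmetric] mult.assoc)
  also have "ennreal (1 / 5) * (2 * ennreal (\<Sum>i\<in>J. h i)) = ennreal (2 / 5 * (\<Sum>i\<in>J. h i))"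
    by (simp add: ennreal_mult'[symmetric] flip: ennreal_numeral)
  finally show ?thesis unfolding J_def h_def .
qed

lemma ennreal_mult_inverse_numeral:
  "0 \<le> x \<Longrightarrow> ennreal x * inverse (numeral n) = ennreal (x / numeral n)"
  using divide_ennreal[of x "numeral n"] by (simp add: divide_ennreal_def)

lemma emeasure_pentagon:
  "emeasure lborel pentagon = ennreal ((\<Sum>j\<in>{1,2,3}. orient (vtx 0) (vtx j) (vtx (Suc j))) / 2)"
proof -
  have tri: "(\<integral>\<^sup>+z. 1 * indicator (convex hull {vtx 0, vtx j, vtx (Suc j)}) z \<partial>lborel)
      = ennreal (orient (vtx 0) (vtx j) (vtx (Suc j)) / 2)" if "j \<in> {1,2,3}" for j
  proof -
    have "0 < orient (vtx 0) (vtx j) (vtx (Suc j))"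
      by (rule orient_pentagon_vertex_pos) (use that in auto)
    then show ?thesis
      using nn_integral_unit_power[of 1]
      by (subst nn_integral_triangle) (auto simp: orient_def ennreal_mult_inverse_numeral)
  qed
  have "emeasure lborel pentagon = (\<integral>\<^sup>+z. 1 * indicator pentagon z \<partial>lborel)"
    by simp
  also have "\<dots> = (\<Sum>j\<in>{1,2,3}. \<integral>\<^sup>+z. 1 * indicator (convex hull {vtx 0, vtx j, vtx (Suc j)}) z \<partial>lborel)"
    by (rule nn_integral_pentagon_vertex_fan) measurable
  also have "\<dots> = (\<Sum>j\<in>{1,2,3}. ennreal (orient (vtx 0) (vtx j) (vtx (Suc j)) / 2))"
    by (intro sum.cong refl tri)
  also have "\<dots> = ennreal ((\<Sum>j\<in>{1,2,3}. orient (vtx 0) (vtx j) (vtx (Suc j))) / 2)"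
    unfolding sum_divide_distrib by (rule sum_ennreal) (auto intro!: orient_pentagon_vertex_nonneg)
  finally show ?thesis .
qed

text \<open>The distance to the apex scales with t and the Jacobian contributes another t, so the
  radial integral is that of t^2, namely 1 / 3.\<close>

lemma nn_integral_dist_apex:
  assumes "cross (u - p) (v - p) \<noteq> 0"
  shows "(\<integral>\<^sup>+z. ennreal (dist p z) * indicator (convex hull {p, u, v}) z \<partial>lborel) =
    ennreal (\<bar>cross (u - p) (v - p)\<bar> / 3) *
      (\<integral>\<^sup>+s. ennreal (dist p ((1 - of_real s) * u + of_real s * v)) \<partial>unit_measure)"
proof -
  let ?D = "\<integral>\<^sup>+s. ennreal (dist p ((1 - of_real s) * u + of_real s * v)) \<partial>unit_measure"
  have "(\<integral>\<^sup>+t. ennreal t * (\<integral>\<^sup>+s. ennreal (dist p (p + of_real t * ((1 - of_real s) * (u - p) + of_real s * (v - p)))) \<partial>unit_measure) \<partial>unit_measure)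
    = (\<integral>\<^sup>+t. ennreal (t ^ 2) * ?D \<partial>unit_measure)"
  proof (rule nn_integral_cong_AE, use AE_unit_measure in eventually_elim)
    case (elim t)
    have "dist p (p + of_real t * ((1 - of_real s) * (u - p) + of_real s * (v - p)))
        = t * dist p ((1 - of_real s) * u + of_real s * v)" for s
    proof -
      have "(1 - of_real s) * (u - p) + of_real s * (v - p) = - (p - ((1 - of_real s) * u + of_real s * v))"
        by (simp add: algebra_simps)
      then show ?thesis using elim by (simp only: dist_norm norm_mult norm_minus_cancel) (simp add: norm_mult norm_minus_commute)
    qed
    then have "(\<integral>\<^sup>+s. ennreal (dist p (p + of_real t * ((1 - of_real s) * (u - p) + of_real s * (v - p)))) \<partial>unit_measure)
        = ennreal t * ?D"
      using elim by (simp add: ennreal_mult' nn_integral_cmult)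
    then show ?case using elim by (simp add: mult.assoc[symmetric] ennreal_mult'[symmetric] power2_eq_square)
  qed
  also have "\<dots> = (\<integral>\<^sup>+t. ennreal (t ^ 2) \<partial>unit_measure) * ?D"
    by (rule nn_integral_multc) measurable
  also have "\<dots> = ennreal (1 / 3) * ?D"
    by (subst nn_integral_unit_power) simp
  finally show ?thesis
    using assms by (subst nn_integral_triangle) (auto simp: mult.assoc[symmetric] ennreal_mult'[symmetric])
qed

lemma nn_integral_distance_potential_edge:
  "(\<integral>\<^sup>+s. distance_potential (edge_point 0 s) \<partial>unit_measure) =
    (\<Sum>j\<in>{1,2,3,4}. \<integral>\<^sup>+s. \<integral>\<^sup>+t. ennreal (orient (edge_point 0 s) (vtx j) (vtx (Suc j)) / 3 * dist (edge_point 0 s) (edge_point j t)) \<partial>unit_measure \<partial>unit_measure)"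
proof -
  have [measurable]: "(\<lambda>s. orient (edge_point 0 s) (vtx j) (vtx (Suc j))) \<in> borel_measurable borel" for j
    unfolding orient_edge_point by measurable
  have "(\<integral>\<^sup>+s. distance_potential (edge_point 0 s) \<partial>unit_measure) =
    (\<integral>\<^sup>+s. (\<Sum>j\<in>{1,2,3,4}. \<integral>\<^sup>+t. ennreal (orient (edge_point 0 s) (vtx j) (vtx (Suc j)) / 3 * dist (edge_point 0 s) (edge_point j t)) \<partial>unit_measure) \<partial>unit_measure)"
  proof (rule nn_integral_cong_AE, use AE_unit_measure in eventually_elim)
    case (elim s)
    have "distance_potential (edge_point 0 s) = (\<Sum>j\<in>{1,2,3,4}. \<integral>\<^sup>+z. ennreal (dist (edge_point 0 s) z) * indicator (convex hull {edge_point 0 s, vtx j, vtx (Suc j)}) z \<partial>lborel)"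
      unfolding distance_potential_def by (rule nn_integral_pentagon_edge_fan) (use elim in auto)
    also have "\<dots> = (\<Sum>j\<in>{1,2,3,4}. \<integral>\<^sup>+t. ennreal (orient (edge_point 0 s) (vtx j) (vtx (Suc j)) / 3 * dist (edge_point 0 s) (edge_point j t)) \<partial>unit_measure)"
    proof (intro sum.cong refl)
      fix j :: nat assume j: "j \<in> {1,2,3,4}"
      have pos: "0 < orient (edge_point 0 s) (vtx j) (vtx (Suc j))"
        by (rule orient_edge_point_pos) (use j elim in auto)
      then have "(\<integral>\<^sup>+z. ennreal (dist (edge_point 0 s) z) * indicator (convex hull {edge_point 0 s, vtx j, vtx (Suc j)}) z \<partial>lborel)
        = ennreal (orient (edge_point 0 s) (vtx j) (vtx (Suc j)) / 3) * (\<integral>\<^sup>+t. ennreal (dist (edge_point 0 s) (edge_point j t)) \<partial>unit_measure)"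
        by (subst nn_integral_dist_apex) (auto simp: orient_def edge_point_def)
      also have "\<dots> = (\<integral>\<^sup>+t. ennreal (orient (edge_point 0 s) (vtx j) (vtx (Suc j)) / 3 * dist (edge_point 0 s) (edge_point j t)) \<partial>unit_measure)"
        using pos by (subst nn_integral_cmult[symmetric]) (auto simp: ennreal_mult'[symmetric])
      finally show "(\<integral>\<^sup>+z. ennreal (dist (edge_point 0 s) z) * indicator (convex hull {edge_point 0 s, vtx j, vtx (Suc j)}) z \<partial>lborel)
        = (\<integral>\<^sup>+t. ennreal (orient (edge_point 0 s) (vtx j) (vtx (Suc j)) / 3 * dist (edge_point 0 s) (edge_point j t)) \<partial>unit_measure)" .
    qed
    finally show ?case .
  qed
  also have "\<dots> = (\<Sum>j\<in>{1,2,3,4}. \<integral>\<^sup>+s. \<integral>\<^sup>+t. ennreal (orient (edge_point 0 s) (vtx j) (vtx (Suc j)) / 3 * dist (edge_point 0 s) (edge_point j t)) \<partial>unit_measure \<partial>unit_measure)"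
    by (rule nn_integral_sum) measurable
  finally show ?thesis .
qed

subsection \<open>Coordinates of the regular pentagon\<close>

lemma cos_sin_72:
  defines "x \<equiv> cos (2 * pi / 5)" and "y \<equiv> sin (2 * pi / 5)"
  shows "x = (sqrt 5 - 1) / 4" "0 < y" "y * y = 1 - x * x"
proof -
  have x: "0 < x" unfolding x_def by (rule cos_gt_zero) auto
  have x1: "x < 1" unfolding x_def using cos_monotone_0_pi[of 0 "2 * pi / 5"] by simp
  show "0 < y" unfolding y_def by (rule sin_gt_zero) auto
  show yy: "y * y = 1 - x * x"
    unfolding x_def y_def using sin_squared_eq[of "2 * pi / 5"] by (simp add: power2_eq_square)
  \<comment> \<open>The triple and the double of 72 degrees add up to a full turn. The resulting
    cubic has the spurious root 1; the remaining quadratic has one positive root.\<close>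
  have "cos (3 * (2 * pi / 5)) = cos (2 * pi - 2 * (2 * pi / 5))"
    by (rule arg_cong[of _ _ cos]) (simp add: field_simps)
  also have "\<dots> = cos (2 * (2 * pi / 5))"
    by (rule cos_2pi_minus)
  finally have "4 * x ^ 3 - 3 * x = 2 * x\<^sup>2 - 1"
    unfolding x_def cos_treble_cos cos_double_cos .
  then have "(x - 1) * (4 * x\<^sup>2 + 2 * x - 1) = 0"
    by (simp add: power2_eq_square power3_eq_cube algebra_simps)
  then have "4 * x\<^sup>2 + 2 * x - 1 = 0" using x1 by simp
  then have "(4 * x + 1)\<^sup>2 = 5" by (simp add: power2_eq_square algebra_simps)
  then have "4 * x + 1 = sqrt 5" using x by (intro real_sqrt_unique[symmetric]) auto
  then show "x = (sqrt 5 - 1) / 4" by simp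
qed

definition c72 :: real where "c72 = (sqrt 5 - 1) / 4"

definition s72 :: real where "s72 = sin (2 * pi / 5)"

text \<open>The side length for circumradius 1, by the law of cosines in a central triangle.\<close>

definition side72 :: real where "side72 = sqrt (2 - 2 * c72)"

text \<open>The two quadratic relations determine all coordinate identities below: they are the
  hypotheses given to \<open>algebra\<close>.\<close>

lemma c72_sq: "4 * (c72 * c72) = 1 - 2 * c72" and s72_sq: "4 * (s72 * s72) = 3 + 2 * c72" and s72_pos: "0 < s72"
  and c72_bounds: "0 < c72" "2 * c72 < 1" and side72_pos: "0 < side72"
proof -
  have "sqrt 5 < sqrt (3\<^sup>2)" "sqrt (1\<^sup>2) < sqrt 5" by (rule real_sqrt_less_mono, simp)+
  then show b: "0 < c72" "2 * c72 < 1" by (simp_all add: c72_def)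
  show 1: "4 * (c72 * c72) = 1 - 2 * c72" by (simp add: c72_def field_simps)
  then show "4 * (s72 * s72) = 3 + 2 * c72" unfolding s72_def cos_sin_72(3) cos_sin_72(1) c72_def[symmetric] by simp
  show "0 < s72" unfolding s72_def by (rule cos_sin_72)
  show "0 < side72" using b by (auto simp: side72_def)
qed

lemma pentagon_vertex_coordinates:
  "vtx 0 = 1" "vtx (Suc 0) = Complex c72 s72" "vtx 2 = Complex (- c72 - 1/2) (2 * c72 * s72)"
  "vtx 3 = Complex (- c72 - 1/2) (- 2 * c72 * s72)" "vtx 4 = Complex c72 (- s72)" "vtx 5 = 1"
proof -
  have v1: "vtx 1 = Complex c72 s72"
    using cos_sin_72(1) by (simp add: pentagon_vertex_def complex_eq_iff c72_def s72_def)
  have xx: "c72 * c72 = (1 - 2 * c72) / 4" and yy: "s72 * s72 = (3 + 2 * c72) / 4"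
    using c72_sq s72_sq by simp_all
  have v2: "vtx 2 = Complex (- c72 - 1/2) (2 * c72 * s72)"
    using pentagon_vertex_mult[of 1 1] unfolding v1 by (auto simp: complex_eq_iff xx yy numeral_2_eq_2 field_simps)
  have v4: "vtx 4 = Complex c72 (- s72)"
  proof -
    have "vtx 4 = cis (2 * pi - 2 * pi / 5)"
      unfolding pentagon_vertex_def by (rule arg_cong[of _ _ cis]) (simp add: field_simps)
    also have "\<dots> = cnj (vtx 1)"
      by (simp only: complex_eq_iff pentagon_vertex_def complex_cnj cis.sel cos_2pi_minus sin_2pi_minus) simp
    finally show ?thesis unfolding v1 by (simp add: complex_eq_iff)
  qed
  have v3: "vtx 3 = Complex (- c72 - 1/2) (- 2 * c72 * s72)"
  proof -
    have "vtx 3 = cis (2 * pi - 2 * pi * 2 / 5)"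
      unfolding pentagon_vertex_def by (rule arg_cong[of _ _ cis]) (simp add: field_simps)
    also have "\<dots> = cnj (vtx 2)"
      by (simp only: complex_eq_iff pentagon_vertex_def complex_cnj cis.sel cos_2pi_minus sin_2pi_minus) simp
    finally show ?thesis unfolding v2 by (simp add: complex_eq_iff)
  qed
  show "vtx 0 = 1" "vtx (Suc 0) = Complex c72 s72" "vtx 2 = Complex (- c72 - 1/2) (2 * c72 * s72)"
    "vtx 3 = Complex (- c72 - 1/2) (- 2 * c72 * s72)" "vtx 4 = Complex c72 (- s72)" "vtx 5 = 1"
    using v1 v2 v3 v4 pentagon_vertex_add_5[of 0] by (simp_all add: pentagon_vertex_def)
qed

text \<open>The factor 1 + 2 c72 is the golden ratio, the ratio of diagonal to side; it separates
  the triangles with two diagonals from those with one. The zeros belong to a repeated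
  vertex.\<close>

lemma pentagon_orients:
  "orient (vtx 0) (vtx 1) (vtx 2) = s72 * (2 - 2 * c72)"
  "orient (vtx 0) (vtx 2) (vtx 3) = s72 * (2 - 2 * c72) * (1 + 2 * c72)"
  "orient (vtx 0) (vtx 3) (vtx 4) = s72 * (2 - 2 * c72)"
  "orient (vtx 1) (vtx 2) (vtx 3) = s72 * (2 - 2 * c72)"
  "orient (vtx 1) (vtx 3) (vtx 4) = s72 * (2 - 2 * c72) * (1 + 2 * c72)"
  "orient (vtx 1) (vtx 4) (vtx 5) = s72 * (2 - 2 * c72)"
  "orient (vtx 0) (vtx 4) (vtx 5) = 0" "orient (vtx 1) (vtx 1) (vtx 2) = 0"
  unfolding One_nat_def orient_def pentagon_vertex_coordinates cross_def using c72_sq s72_sq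
  by (simp_all, algebra+)

text \<open>The arguments of \<open>third_side\<close> are distances to the meeting point of the two
  side lines, in units of the side. Side 0 meets sides 1 and 4 in \<open>vtx 1\<close> and
  \<open>vtx 0\<close>; the lines of sides 2 and 3 meet its line at the star points beyond these
  vertices.\<close>

lemma edge_dist:
  fixes s t :: real
  shows "dist (edge_point 0 s) (edge_point 1 t) = side72 * third_side (- c72) (1 - s) t"
    "dist (edge_point 0 s) (edge_point 4 t) = side72 * third_side (- c72) s (1 - t)"
    "dist (edge_point 0 s) (edge_point 2 t) = side72 * third_side (1/2 + c72) (1 + 2 * c72 + (1 - s)) (1 + 2 * c72 + t)"
    "dist (edge_point 0 s) (edge_point 3 t) = side72 * third_side (1/2 + c72) (1 + 2 * c72 + s) (1 + 2 * c72 + (1 - t))"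
proof -
  have *: "dist z w = side72 * third_side c u v"
    if "(Re z - Re w)\<^sup>2 + (Im z - Im w)\<^sup>2 = (2 - 2 * c72) * (u\<^sup>2 + v\<^sup>2 - 2 * c * u * v)" for z w c u v
    using that by (simp add: dist_norm cmod_def third_side_def side72_def real_sqrt_mult)
  have e: "edge_point 0 s = (1 - of_real s) * vtx 0 + of_real s * vtx (Suc 0)"
    "edge_point 1 t = (1 - of_real t) * vtx (Suc 0) + of_real t * vtx 2"
    "edge_point 2 t = (1 - of_real t) * vtx 2 + of_real t * vtx 3"
    "edge_point 3 t = (1 - of_real t) * vtx 3 + of_real t * vtx 4"
    "edge_point 4 t = (1 - of_real t) * vtx 4 + of_real t * vtx 5"
    by (simp_all add: edge_point_def eval_nat_numeral)
  show "dist (edge_point 0 s) (edge_point 1 t) = side72 * third_side (- c72) (1 - s) t"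
    unfolding e pentagon_vertex_coordinates by (rule *, simp) (use c72_sq s72_sq in algebra)
  show "dist (edge_point 0 s) (edge_point 4 t) = side72 * third_side (- c72) s (1 - t)"
    unfolding e pentagon_vertex_coordinates by (rule *, simp) (use c72_sq s72_sq in algebra)
  show "dist (edge_point 0 s) (edge_point 2 t) = side72 * third_side (1/2 + c72) (1 + 2 * c72 + (1 - s)) (1 + 2 * c72 + t)"
    unfolding e pentagon_vertex_coordinates by (rule *, simp) (use c72_sq s72_sq in algebra)
  show "dist (edge_point 0 s) (edge_point 3 t) = side72 * third_side (1/2 + c72) (1 + 2 * c72 + s) (1 + 2 * c72 + (1 - t))"
    unfolding e pentagon_vertex_coordinates by (rule *, simp) (use c72_sq s72_sq in algebra)
qed

subsection \<open>The mean distance\<close>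

lemma nn_integral_unit_reflect_fst:
  assumes [measurable]: "case_prod g \<in> borel_measurable (borel \<Otimes>\<^sub>M borel)" and k: "0 \<le> (k::real)"
  shows "(\<integral>\<^sup>+s. \<integral>\<^sup>+t. ennreal (k * g (1 - s) t) \<partial>unit_measure \<partial>unit_measure) =
    ennreal k * (\<integral>\<^sup>+s. \<integral>\<^sup>+t. ennreal (g s t) \<partial>unit_measure \<partial>unit_measure)"
proof -
  have "(\<integral>\<^sup>+s. \<integral>\<^sup>+t. ennreal (k * g (1 - s) t) \<partial>unit_measure \<partial>unit_measure)
      = (\<integral>\<^sup>+s. \<integral>\<^sup>+t. ennreal (k * g s t) \<partial>unit_measure \<partial>unit_measure)"
    by (rule nn_integral_unit_reflect[of "\<lambda>s. \<integral>\<^sup>+t. ennreal (k * g s t) \<partial>unit_measure"]) measurable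
  also have "\<dots> = ennreal k * (\<integral>\<^sup>+s. \<integral>\<^sup>+t. ennreal (g s t) \<partial>unit_measure \<partial>unit_measure)"
    using k by (simp add: ennreal_mult' nn_integral_cmult)
  finally show ?thesis .
qed

lemma nn_integral_unit_reflect_snd:
  assumes [measurable]: "case_prod g \<in> borel_measurable (borel \<Otimes>\<^sub>M borel)" and k: "0 \<le> (k::real)"
  shows "(\<integral>\<^sup>+s. \<integral>\<^sup>+t. ennreal (k * g s (1 - t)) \<partial>unit_measure \<partial>unit_measure) =
    ennreal k * (\<integral>\<^sup>+s. \<integral>\<^sup>+t. ennreal (g s t) \<partial>unit_measure \<partial>unit_measure)"
proof -
  have "(\<integral>\<^sup>+s. \<integral>\<^sup>+t. ennreal (k * g s (1 - t)) \<partial>unit_measure \<partial>unit_measure)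
      = (\<integral>\<^sup>+s. \<integral>\<^sup>+t. ennreal (k * g s t) \<partial>unit_measure \<partial>unit_measure)"
    by (intro nn_integral_cong nn_integral_unit_reflect[of "\<lambda>t. ennreal (k * g _ t)"]) measurable
  also have "\<dots> = ennreal k * (\<integral>\<^sup>+s. \<integral>\<^sup>+t. ennreal (g s t) \<partial>unit_measure \<partial>unit_measure)"
    using k by (simp add: ennreal_mult' nn_integral_cmult)
  finally show ?thesis .
qed

text \<open>The integrals of \<open>u * third_side c u v\<close> over pairs of sides, where \<open>u\<close> and \<open>v\<close> are distances to the
  common point of the lines through the sides. Adjacent sides meet in a vertex, at the angle with cosine
  \<open>- c72\<close>. The lines through non-adjacent sides meet, in units of the side length, at distance
  \<open>1 + 2 * c72\<close> (the golden ratio) from the nearer ends, at the angle with cosine \<open>1/2 + c72\<close>;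
  division by the square of the golden ratio turns the sides into \<open>{2 * c72..1}\<close>.\<close>

definition adjacent_sides_integral :: real where
  "adjacent_sides_integral = (side_primitive (- c72) 1 - side_primitive (- c72) 0) / 4"

definition opposite_sides_integral :: real where
  "opposite_sides_integral = ((1 + (2 * c72) ^ 4) * side_primitive (1/2 + c72) 1
     - side_primitive (1/2 + c72) (2 * c72)
     - (2 * c72) ^ 4 * side_primitive (1/2 + c72) (1 / (2 * c72))) / (4 * (1 - 2 * c72)\<^sup>2)"

text \<open>The reflection s -> 1 - s of side 0 exchanges side 1 with side 4 and side 2 with side 3,
  hence the factor 2.\<close>

lemma nn_integral_distance_potential_edge_eq:
  "(\<integral>\<^sup>+s. distance_potential (edge_point 0 s) \<partial>unit_measure) =
    2 * (ennreal (s72 * (2 - 2 * c72) * side72 / 3) * ennreal adjacent_sides_integral +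
         ennreal (s72 * (2 - 2 * c72) * side72 * (1 + 2 * c72) ^ 3 / 3) * ennreal opposite_sides_integral)"
proof -
  define k where "k = s72 * (2 - 2 * c72) * side72 / 3"
  define k' where "k' = s72 * (2 - 2 * c72) * side72 * (1 + 2 * c72) ^ 3 / 3"
  define g where "g u v = u * third_side (- c72) u v" for u v
  define a where "a = 2 * c72"
  define b where "b u = a + (1 - a) * u" for u
  define g' where "g' u v = b u * third_side (1/2 + c72) (b u) (b v)" for u v
  have k: "0 \<le> k" "0 \<le> k'" using s72_pos side72_pos c72_bounds by (auto simp: k_def k'_def intro!: mult_nonneg_nonneg)
  have [measurable]: "case_prod g \<in> borel_measurable (borel \<Otimes>\<^sub>M borel)" "case_prod g' \<in> borel_measurable (borel \<Otimes>\<^sub>M borel)"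
    unfolding g_def g'_def b_def by measurable
  have gi: "(\<integral>\<^sup>+s. \<integral>\<^sup>+t. ennreal (g s t) \<partial>unit_measure \<partial>unit_measure) = ennreal adjacent_sides_integral"
    unfolding g_def adjacent_sides_integral_def
    by (rule nn_integral_third_side_unit_square) (use c72_bounds in auto)
  have gi': "(\<integral>\<^sup>+s. \<integral>\<^sup>+t. ennreal (g' s t) \<partial>unit_measure \<partial>unit_measure) = ennreal opposite_sides_integral"
    unfolding g'_def b_def a_def opposite_sides_integral_def
    by (rule nn_integral_third_side_shifted_square) (use c72_bounds in auto)
  \<comment> \<open>With the golden ratio g = 1 + 2 c72 one has a = 1 / g and 1 - a = 1 / g^2, so g
    + u is g^2 times the affine image of u in [a, 1]. This g^2 and the g in the orientations below
    make up the cube in k'.\<close>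
  have bs: "1 + 2 * c72 + u = (1 + 2 * c72)\<^sup>2 * b u" for u
    using c72_sq unfolding b_def a_def by algebra
  have ts: "third_side (1/2 + c72) (1 + 2 * c72 + u) (1 + 2 * c72 + v) = (1 + 2 * c72)\<^sup>2 * third_side (1/2 + c72) (b u) (b v)" for u v
    unfolding bs by (rule third_side_scale) simp
  have o: "orient (edge_point 0 s) (vtx 1) (vtx (Suc 1)) = (1 - s) * (s72 * (2 - 2 * c72))"
    "orient (edge_point 0 s) (vtx 4) (vtx (Suc 4)) = s * (s72 * (2 - 2 * c72))"
    "orient (edge_point 0 s) (vtx 2) (vtx (Suc 2)) = s72 * (2 - 2 * c72) * (1 + 2 * c72) * b (1 - s)"
    "orient (edge_point 0 s) (vtx 3) (vtx (Suc 3)) = s72 * (2 - 2 * c72) * (1 + 2 * c72) * b s" for s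
  proof -
    have aux: "(1 + 2 * c72) * b u = 1 + 2 * c72 * u" for u
      using c72_sq unfolding b_def a_def by algebra
    show "orient (edge_point 0 s) (vtx 1) (vtx (Suc 1)) = (1 - s) * (s72 * (2 - 2 * c72))"
      "orient (edge_point 0 s) (vtx 4) (vtx (Suc 4)) = s * (s72 * (2 - 2 * c72))"
      unfolding orient_edge_point using pentagon_orients by (simp_all add: eval_nat_numeral)
    show "orient (edge_point 0 s) (vtx 2) (vtx (Suc 2)) = s72 * (2 - 2 * c72) * (1 + 2 * c72) * b (1 - s)"
      "orient (edge_point 0 s) (vtx 3) (vtx (Suc 3)) = s72 * (2 - 2 * c72) * (1 + 2 * c72) * b s"
      unfolding orient_edge_point mult.assoc aux using pentagon_orients
      by (simp_all add: eval_nat_numeral) (simp_all add: algebra_simps)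
  qed
  have e: "orient (edge_point 0 s) (vtx 1) (vtx (Suc 1)) / 3 * dist (edge_point 0 s) (edge_point 1 t) = k * g (1 - s) t"
    "orient (edge_point 0 s) (vtx 4) (vtx (Suc 4)) / 3 * dist (edge_point 0 s) (edge_point 4 t) = k * g s (1 - t)"
    "orient (edge_point 0 s) (vtx 2) (vtx (Suc 2)) / 3 * dist (edge_point 0 s) (edge_point 2 t) = k' * g' (1 - s) t"
    "orient (edge_point 0 s) (vtx 3) (vtx (Suc 3)) / 3 * dist (edge_point 0 s) (edge_point 3 t) = k' * g' s (1 - t)" for s t
    unfolding o edge_dist ts by (simp_all add: k_def k'_def g_def g'_def power2_eq_square power3_eq_cube)
  have "(\<integral>\<^sup>+s. distance_potential (edge_point 0 s) \<partial>unit_measure) =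
    (\<integral>\<^sup>+s. \<integral>\<^sup>+t. ennreal (k * g (1 - s) t) \<partial>unit_measure \<partial>unit_measure) +
    (\<integral>\<^sup>+s. \<integral>\<^sup>+t. ennreal (k' * g' (1 - s) t) \<partial>unit_measure \<partial>unit_measure) +
    (\<integral>\<^sup>+s. \<integral>\<^sup>+t. ennreal (k' * g' s (1 - t)) \<partial>unit_measure \<partial>unit_measure) +
    (\<integral>\<^sup>+s. \<integral>\<^sup>+t. ennreal (k * g s (1 - t)) \<partial>unit_measure \<partial>unit_measure)"
    unfolding nn_integral_distance_potential_edge e[symmetric] by (simp add: add.assoc)
  also have "\<dots> = 2 * (ennreal k * ennreal adjacent_sides_integral + ennreal k' * ennreal opposite_sides_integral)"
    by (simp only: nn_integral_unit_reflect_fst nn_integral_unit_reflect_snd k gi gi'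
        \<open>case_prod g \<in> _\<close> \<open>case_prod g' \<in> _\<close>) (simp add: mult_2 distrib_left add_ac)
  finally show ?thesis unfolding k_def k'_def .
qed

text \<open>This sign is needed to merge the \<open>ennreal\<close> terms into a single real
  number.\<close>

lemma adjacent_sides_integral_nonneg: "0 \<le> adjacent_sides_integral"
proof -
  have c: "\<bar>- c72\<bar> < 1" using c72_bounds by auto
  have "0 \<le> (1 + x) * third_side (- c72) 1 x" if "0 \<le> x" for x
    using that third_side_bounds(2)[OF c, of x] by (intro mult_nonneg_nonneg) auto
  then have "side_primitive (- c72) 0 \<le> side_primitive (- c72) 1"
    by (intro DERIV_nonneg_imp_nondecreasing[where f = "side_primitive (- c72)"])
      (auto intro!: exI side_primitive_deriv[OF c])
  then show ?thesis by (simp add: adjacent_sides_integral_def)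
qed

lemma opposite_sides_integral_nonneg: "0 \<le> opposite_sides_integral"
  unfolding opposite_sides_integral_def
  by (rule nn_integral_third_side_shifted_square) (use c72_bounds in auto)

section \<open>Mean distance as a normalised double integral and its behaviour under
  similarities\<close>

lemma enn2real_divide:
  assumes "0 < m"
  shows "enn2real (x / ennreal m) = enn2real x / m"
  using assms by (cases x) (auto simp: divide_ennreal ennreal_top_divide)

lemma mean_distance_eq:
  assumes [measurable]: "S \<in> sets borel" and S: "emeasure lborel S \<noteq> 0" "emeasure lborel S \<noteq> \<infinity>"
  shows "mean_distance S = enn2real ((\<integral>\<^sup>+x. (\<integral>\<^sup>+y. ennreal (dist x y) * indicator S y \<partial>lborel) * indicator S x \<partial>lborel)
    / emeasure lborel S / emeasure lborel S)"
proof -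
  define U where "U = uniform_measure lborel S"
  have [measurable_cong, simp]: "sets U = sets borel" by (simp add: U_def)
  have "emeasure U (space U) = 1"
    using S by (simp add: U_def ennreal_divide_self less_top)
  then interpret U: finite_measure U
    by (intro finite_measureI) simp
  have "mean_distance S = (LINT p|(U \<Otimes>\<^sub>M U). dist (fst p) (snd p))"
    unfolding mean_distance_def U_def by (rule Bochner_Integration.integral_cong) auto
  also have "\<dots> = enn2real (\<integral>\<^sup>+p. ennreal (dist (fst p) (snd p)) \<partial>(U \<Otimes>\<^sub>M U))"
    by (rule integral_eq_nn_integral) auto
  also have "(\<integral>\<^sup>+p. ennreal (dist (fst p) (snd p)) \<partial>(U \<Otimes>\<^sub>M U)) = (\<integral>\<^sup>+x. \<integral>\<^sup>+y. ennreal (dist x y) \<partial>U \<partial>U)"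
    by (subst U.nn_integral_fst[symmetric]) auto
  also have "\<dots> = (\<integral>\<^sup>+x. (\<integral>\<^sup>+y. ennreal (dist x y) * indicator S y \<partial>lborel) / emeasure lborel S * indicator S x \<partial>lborel) / emeasure lborel S"
    unfolding U_def by (subst (1 2) nn_integral_uniform_measure) auto
  also have "(\<integral>\<^sup>+x. (\<integral>\<^sup>+y. ennreal (dist x y) * indicator S y \<partial>lborel) / emeasure lborel S * indicator S x \<partial>lborel)
    = (\<integral>\<^sup>+x. (\<integral>\<^sup>+y. ennreal (dist x y) * indicator S y \<partial>lborel) * indicator S x / emeasure lborel S \<partial>lborel)"
    by (intro nn_integral_cong) (simp add: divide_ennreal_def mult_ac)
  also have "\<dots> = (\<integral>\<^sup>+x. (\<integral>\<^sup>+y. ennreal (dist x y) * indicator S y \<partial>lborel) * indicator S x \<partial>lborel) / emeasure lborel S"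
    by (rule nn_integral_divide) measurable
  finally show ?thesis .
qed

text \<open>Each of the two integrations contributes the squared norm of \<open>a\<close>, which the
  two normalisations by area cancel; only the scaling of the distance remains.\<close>

lemma mean_distance_similarity:
  assumes [measurable]: "S \<in> sets borel" and S: "emeasure lborel S \<noteq> 0" "emeasure lborel S \<noteq> \<infinity>"
    and a: "a \<noteq> (0::complex)" and [measurable]: "(\<lambda>z. p + a * z) ` S \<in> sets borel"
  shows "mean_distance ((\<lambda>z. p + a * z) ` S) = norm a * mean_distance S"
proof -
  define f where "f z = p + a * z" for z
  have [measurable]: "f ` S \<in> sets borel" unfolding f_def by measurable
  define n where "n = norm a"
  have n: "0 < n" using a by (simp add: n_def)
  have ind: "indicator (f ` S) (f z) = (indicator S z :: ennreal)" for z
    using a by (auto simp: indicator_def f_def)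
  have subst: "(\<integral>\<^sup>+z. g z * indicator (f ` S) z \<partial>lborel) = ennreal (n\<^sup>2) * (\<integral>\<^sup>+z. g (f z) * indicator S z \<partial>lborel)"
    if [measurable]: "g \<in> borel_measurable borel" for g
    using nn_integral_similarity[of "\<lambda>z. g z * indicator (f ` S) z" a p, folded f_def] a
    by (simp add: ind n_def)
  have em: "emeasure lborel (f ` S) = ennreal (n\<^sup>2) * emeasure lborel S"
    using subst[of "\<lambda>_. 1"] by simp
  define I where "I = (\<integral>\<^sup>+x. (\<integral>\<^sup>+y. ennreal (dist x y) * indicator S y \<partial>lborel) * indicator S x \<partial>lborel)"
  have d: "dist (f x) (f y) = n * dist x y" for x y
    by (simp add: f_def dist_norm n_def right_diff_distrib[symmetric] norm_mult)
  have inner: "(\<integral>\<^sup>+y. ennreal (dist (f x) y) * indicator (f ` S) y \<partial>lborel)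
      = ennreal (n\<^sup>2 * n) * (\<integral>\<^sup>+y. ennreal (dist x y) * indicator S y \<partial>lborel)" for x
    using n by (subst subst) (auto simp: d ennreal_mult' mult.assoc nn_integral_cmult)
  have "(\<integral>\<^sup>+x. (\<integral>\<^sup>+y. ennreal (dist x y) * indicator (f ` S) y \<partial>lborel) * indicator (f ` S) x \<partial>lborel)
      = ennreal (n\<^sup>2) * (\<integral>\<^sup>+x. ennreal (n\<^sup>2 * n) * (\<integral>\<^sup>+y. ennreal (dist x y) * indicator S y \<partial>lborel) * indicator S x \<partial>lborel)"
    by (subst subst) (auto simp: inner)
  also have "\<dots> = ennreal (n\<^sup>2) * (ennreal (n\<^sup>2 * n) * I)"
    unfolding I_def mult.assoc by (subst nn_integral_cmult) auto
  finally have I: "(\<integral>\<^sup>+x. (\<integral>\<^sup>+y. ennreal (dist x y) * indicator (f ` S) y \<partial>lborel) * indicator (f ` S) x \<partial>lborel)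
      = ennreal (n\<^sup>2) * (ennreal (n\<^sup>2 * n) * I)" .
  obtain m where m: "emeasure lborel S = ennreal m" "0 < m"
    using S by (cases "emeasure lborel S") (auto simp: less_le)
  have em': "emeasure lborel (f ` S) = ennreal (n\<^sup>2 * m)"
    using n by (simp add: em m ennreal_mult')
  have "mean_distance (f ` S) = enn2real (ennreal (n\<^sup>2) * (ennreal (n\<^sup>2 * n) * I)) / (n\<^sup>2 * m) / (n\<^sup>2 * m)"
    using n m by (subst mean_distance_eq) (auto simp: em' I enn2real_divide)
  also have "\<dots> = n * (enn2real I / m / m)"
    using n m by (simp add: enn2real_mult field_simps power2_eq_square)
  also have "enn2real I / m / m = mean_distance S"
    using S m by (subst mean_distance_eq) (auto simp: I_def enn2real_divide)
  finally show ?thesis unfolding f_def n_def .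
qed

lemma sum_pentagon_orients:
  "(\<Sum>j\<in>{1,2,3}. orient (vtx 0) (vtx j) (vtx (Suc j))) = s72 * (2 - 2 * c72) * (3 + 2 * c72)"
  using pentagon_orients by (simp add: eval_nat_numeral) (simp add: algebra_simps)

lemma emeasure_pentagon_eq: "emeasure lborel pentagon = ennreal (s72 * (2 - 2 * c72) * (3 + 2 * c72) / 2)"
  unfolding emeasure_pentagon sum_pentagon_orients ..

lemma mean_distance_pentagon:
  "mean_distance pentagon = 16 / 15 * side72 * (adjacent_sides_integral + (1 + 2 * c72) ^ 3 * opposite_sides_integral) / (3 + 2 * c72)"
proof -
  define R where "R = s72 * (2 - 2 * c72)"
  have R: "0 < R" using s72_pos c72_bounds by (simp add: R_def)
  have H: "(\<Sum>j\<in>{1,2,3}. orient (vtx 0) (vtx j) (vtx (Suc j))) = R * (3 + 2 * c72)"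
    unfolding sum_pentagon_orients R_def ..
  define A B where "A = adjacent_sides_integral" and "B = opposite_sides_integral"
  have AB: "0 \<le> A" "0 \<le> B"
    by (simp_all add: A_def B_def adjacent_sides_integral_nonneg opposite_sides_integral_nonneg)
  have em: "emeasure lborel pentagon = ennreal (R * (3 + 2 * c72) / 2)"
    unfolding emeasure_pentagon H ..
  have L: "0 < side72" and x: "0 < c72" using side72_pos c72_bounds by auto
  have "(\<integral>\<^sup>+s. distance_potential (edge_point 0 s) \<partial>unit_measure) = ennreal (2 * (R * side72 / 3 * A + R * side72 * (1 + 2 * c72) ^ 3 / 3 * B))"
    unfolding nn_integral_distance_potential_edge_eq R_def[symmetric] A_def[symmetric] B_def[symmetric]
    using R L x AB by (simp only: ennreal_mult'[symmetric] ennreal_plus[symmetric] ennreal_numeral[symmetric] mult_nonneg_nonneg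
      divide_nonneg_nonneg less_imp_le zero_le_power add_nonneg_nonneg zero_le_numeral zero_le_one)
  then have "(\<integral>\<^sup>+x. (\<integral>\<^sup>+y. ennreal (dist x y) * indicator pentagon y \<partial>lborel) * indicator pentagon x \<partial>lborel)
    = ennreal (2 / 5 * (R * (3 + 2 * c72))) * ennreal (2 * (R * side72 / 3 * A + R * side72 * (1 + 2 * c72) ^ 3 / 3 * B))"
    unfolding distance_potential_def[symmetric] nn_integral_pentagon_distance H by simp
  moreover have "0 \<le> 2 * (R * side72 / 3 * A + R * side72 * (1 + 2 * c72) ^ 3 / 3 * B)"
    using R L x AB by simp
  ultimately have "mean_distance pentagon = 2 / 5 * (R * (3 + 2 * c72)) * (2 * (R * side72 / 3 * A + R * side72 * (1 + 2 * c72) ^ 3 / 3 * B))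
      / (R * (3 + 2 * c72) / 2) / (R * (3 + 2 * c72) / 2)"
    using R x by (subst mean_distance_eq) (auto simp: em enn2real_mult enn2real_divide)
  \<comment> \<open>With R h the sum of the orientations, the area is R h / 2 and R cancels; the
    constant is (2/5) * (2/3) * 4 = 16/15.\<close>
  also have "\<dots> = 16 / 15 * side72 * (A + (1 + 2 * c72) ^ 3 * B) / (3 + 2 * c72)"
  proof -
    have "2 / 5 * (R * h) * (2 * (R * side72 / 3 * A + R * side72 * w / 3 * B)) / (R * h / 2) / (R * h / 2)
        = 16 / 15 * side72 * (A + w * B) / h" if "0 < h" for h w
      using that R by (simp add: field_simps)
    then show ?thesis using x by simp
  qed
  finally show ?thesis unfolding A_def B_def .
qed

section \<open>Evaluation in the field Q(sqrt 5)\<close>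

lemma third_side_eqI:
  assumes "0 \<le> z" "z * z = u * u + v * v - 2 * c * u * v"
  shows "third_side c u v = z"
  unfolding third_side_def using assms by (intro real_sqrt_unique) (simp_all add: power2_eq_square)

text \<open>All arguments of logarithms are products of sqrt 5, powers of the golden ratio and 1 /
  2. In the adjacent case only ln (sqrt 5) survives the difference; in the opposite case ln 2
  cancels and three times the logarithm of the golden ratio remains.\<close>

lemma sides_integrals_closed_form:
  defines "q \<equiv> sqrt 5"
  shows "adjacent_sides_integral = (((q + 1) / 2) ^ 3 / 3 - 1 / 3 +
      (1 - c72) / 2 * ((1 + c72) * ((q + 1) / 2) - c72 + (1 - c72\<^sup>2) * (ln 5 / 2))) / 4"
    and "opposite_sides_integral = ((1 + (2 * c72) ^ 4) * (((q - 1) / 2) ^ 3 / 3 + (1 + (1/2 + c72)) / 2 * (1 - (1/2 + c72)) * ((q - 1) / 2))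
      - (((q - 1) / 2) ^ 3 / 3 + (1 + (1/2 + c72)) / 2 * (2 * c72 - (1/2 + c72)) * ((q - 1) / 2))
      - (2 * c72) ^ 4 * (1 / 3 + (1 + (1/2 + c72)) / 2 * ((q + 1) / 2 - (1/2 + c72)))
      - (1 + (1/2 + c72)) / 2 * (1 - (1/2 + c72)\<^sup>2) * (ln (q - 2) + (1 + (2 * c72) ^ 4) * (ln 5 / 2))) / (4 * (1 - 2 * c72)\<^sup>2)"
proof -
  have q: "q * q = 5" by (simp add: q_def)
  have q': "q * (q * z) = 5 * z" for z using q by (simp add: mult.assoc[symmetric])
  have q2: "2 < q" unfolding q_def by (rule real_less_rsqrt) simp
  have c: "c72 = (q - 1) / 4" by (simp add: c72_def q_def)
  have inv: "1 / (2 * c72) = (q + 1) / 2"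
    unfolding c using q q2 by (simp add: field_simps)
  have ln5: "ln q = ln 5 / 2" unfolding q_def by (simp add: ln_sqrt)
  define l where "l = ln ((q + 1) / 2)"
  have inv_phi: "(q - 1) / 2 = inverse ((q + 1) / 2)" using q q2 by (simp add: field_simps)
  have ln_inv: "ln ((q - 1) / 2) = - l"
    unfolding inv_phi l_def using q2 by (subst ln_inverse) auto
  \<comment> \<open>The term ln (sqrt 5 - 2) of the final formula is minus three times the logarithm
    of the golden ratio.\<close>
  have cube: "q - 2 = ((q - 1) / 2) ^ 3"
    by (simp add: power3_eq_cube field_simps q q')
  have ln_cube: "ln (q - 2) = - 3 * l"
    unfolding cube using q2 by (subst ln_realpow) (simp_all add: ln_inv)
  have ts: "third_side (- c72) 1 1 = (q + 1) / 2" "third_side (- c72) 1 0 = 1"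
    "third_side (1/2 + c72) 1 1 = (q - 1) / 2" "third_side (1/2 + c72) 1 (2 * c72) = (q - 1) / 2"
    "third_side (1/2 + c72) 1 ((q + 1) / 2) = 1"
    unfolding c using q2 by - (rule third_side_eqI; simp add: field_simps q q')+
  have args: "1 - - c72 + (q + 1) / 2 = q * ((q + 1) / 2)\<^sup>2 / 2"
    "0 - - c72 + 1 = ((q + 1) / 2)\<^sup>2 / 2"
    "1 - (1/2 + c72) + (q - 1) / 2 = (q + 1) / 2 / 2"
    "2 * c72 - (1/2 + c72) + (q - 1) / 2 = q * ((q - 1) / 2)\<^sup>2 / 2"
    "(q + 1) / 2 - (1/2 + c72) + 1 = q * ((q + 1) / 2) / 2"
    unfolding c power2_eq_square by (simp_all add: field_simps q q')
  have ln_half: "ln (a * b\<^sup>2 / 2) = ln a + 2 * ln b - ln 2" "ln (a * b / 2) = ln a + ln b - ln 2"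
    "ln (b\<^sup>2 / 2) = 2 * ln b - ln 2" "ln (b / 2) = ln b - ln 2"
    if "0 < a" "0 < b" for a b :: real
    using that by (simp_all add: ln_div ln_mult ln_realpow)
  have p: "0 < q" "0 < (q + 1) / 2" "0 < (q - 1) / 2"
    using q2 by auto
  note logs = ln_half[OF p(1,2), folded l_def, unfolded ln5] ln_half(1)[OF p(1,3), unfolded ln5 ln_inv]
  \<comment> \<open>Here t stands for ln 2, f for ln (sqrt 5), l for the logarithm of the golden
    ratio and T for the fourth power of the cut-off. The coefficients of t cancel and those of l
    leave 3.\<close>
  have collect: "(1 + T) * (P / 3 + h * (u * N + s * (l - t))) - (P / 3 + h * (w * N + s * (f + 2 * - l - t)))
      - T * (1 / 3 + h * (z + s * (f + l - t)))
    = (1 + T) * (P / 3 + h * u * N) - (P / 3 + h * w * N) - T * (1 / 3 + h * z) - h * s * (- 3 * l + (1 + T) * f)"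
    for T P h u w z N s t f :: real
    by (simp add: algebra_simps)
  show "adjacent_sides_integral = (((q + 1) / 2) ^ 3 / 3 - 1 / 3 +
      (1 - c72) / 2 * ((1 + c72) * ((q + 1) / 2) - c72 + (1 - c72\<^sup>2) * (ln 5 / 2))) / 4"
    unfolding adjacent_sides_integral_def side_primitive_def ts args logs
    by (simp add: field_simps)
  show "opposite_sides_integral = ((1 + (2 * c72) ^ 4) * (((q - 1) / 2) ^ 3 / 3 + (1 + (1/2 + c72)) / 2 * (1 - (1/2 + c72)) * ((q - 1) / 2))
      - (((q - 1) / 2) ^ 3 / 3 + (1 + (1/2 + c72)) / 2 * (2 * c72 - (1/2 + c72)) * ((q - 1) / 2))
      - (2 * c72) ^ 4 * (1 / 3 + (1 + (1/2 + c72)) / 2 * ((q + 1) / 2 - (1/2 + c72)))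
      - (1 + (1/2 + c72)) / 2 * (1 - (1/2 + c72)\<^sup>2) * (ln (q - 2) + (1 + (2 * c72) ^ 4) * (ln 5 / 2))) / (4 * (1 - 2 * c72)\<^sup>2)"
    unfolding opposite_sides_integral_def side_primitive_def inv ts args logs ln_cube
    by (simp only: power_one mult_1_right collect)
qed

text \<open>This form isolates the factor sqrt 2 * sqrt (5 + sqrt 5) of the result, the only part
  outside Q(sqrt 5) apart from the logarithms.\<close>

lemma side72_eq: "side72 = sqrt 2 * sqrt (5 + sqrt 5) * (sqrt 5 - 1) / 4"
proof -
  have q: "sqrt 5 * sqrt 5 = (5::real)" "sqrt 5 * (sqrt 5 * z) = 5 * z" for z :: real
    by (simp_all add: mult.assoc[symmetric])
  have "(sqrt 2 * sqrt (5 + sqrt 5) * (sqrt 5 - 1) / 4)\<^sup>2 = 2 * (5 + sqrt 5) * (sqrt 5 - 1)\<^sup>2 / 16"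
    by (simp add: power_mult_distrib power_divide)
  also have "\<dots> = 2 - 2 * c72"
    unfolding c72_def power2_eq_square by (simp add: field_simps q)
  finally show ?thesis
    unfolding side72_def by (intro real_sqrt_unique) auto
qed

lemma mean_distance_pentagon_closed_form:
  "mean_distance pentagon = sqrt 2 / 480 * sqrt (5 + sqrt 5) *
      (24 * sqrt 5 - 8 - (35 + 9 * sqrt 5) * ln 5
        - 2 * (25 + 11 * sqrt 5) * ln (sqrt 5 - 2))"
proof -
  define q where "q = sqrt (5::real)"
  define k where "k = sqrt 2 * sqrt (5 + q)"
  define l l' where "l = ln (5::real)" and "l' = ln (q - 2)"
  have q: "q * q = 5" by (simp add: q_def)
  have q': "q * (q * z) = 5 * z" for z using q by (simp add: mult.assoc[symmetric])
  have qpos: "0 < q" by (simp add: q_def)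
  have c: "c72 = (q - 1) / 4" by (simp add: c72_def q_def)
  \<comment> \<open>Rationalised reciprocals turn the final comparison into a polynomial identity in
    q, l and l', which is checked by rewriting with q * q = 5.\<close>
  have inv1: "1 / (3 + 2 * c72) = (5 - q) / 10"
    unfolding c using q qpos by (simp add: field_simps)
  have inv2: "z / (4 * (1 - 2 * c72)\<^sup>2) = z * ((7 + 3 * q) / 8)" for z
  proof -
    have "(4 * (1 - 2 * c72)\<^sup>2) * ((7 + 3 * q) / 8) = 1"
      unfolding c power2_eq_square by (simp add: field_simps q q')
    then show ?thesis by (metis divide_inverse inverse_unique)
  qed
  have powers: "((q + 1) / 2) ^ 3 = q + 2" "((q - 1) / 2) ^ 3 = q - 2" "(1 + 2 * c72) ^ 3 = q + 2"
    "c72\<^sup>2 = (3 - q) / 8" "(1/2 + c72)\<^sup>2 = (3 + q) / 8" "(2 * c72) ^ 4 = (7 - 3 * q) / 2"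
    unfolding c by (simp_all add: eval_nat_numeral field_simps q q')
  have A: "adjacent_sides_integral = ((q + 2) / 3 - 1 / 3 +
      (1 - c72) / 2 * ((1 + c72) * ((q + 1) / 2) - c72 + (1 - (3 - q) / 8) * (l / 2))) / 4"
    unfolding sides_integrals_closed_form q_def[symmetric] powers l_def ..
  have B: "opposite_sides_integral = ((1 + (7 - 3 * q) / 2) * ((q - 2) / 3 + (1 + (1/2 + c72)) / 2 * (1 - (1/2 + c72)) * ((q - 1) / 2))
      - ((q - 2) / 3 + (1 + (1/2 + c72)) / 2 * (2 * c72 - (1/2 + c72)) * ((q - 1) / 2))
      - (7 - 3 * q) / 2 * (1 / 3 + (1 + (1/2 + c72)) / 2 * ((q + 1) / 2 - (1/2 + c72)))
      - (1 + (1/2 + c72)) / 2 * (1 - (3 + q) / 8) * (l' + (1 + (7 - 3 * q) / 2) * (l / 2))) * ((7 + 3 * q) / 8)"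
    unfolding sides_integrals_closed_form q_def[symmetric] powers inv2 l_def l'_def ..
  have "mean_distance pentagon = k * (16 / 15 * ((q - 1) / 4) * (adjacent_sides_integral + (q + 2) * opposite_sides_integral) * ((5 - q) / 10))"
    unfolding mean_distance_pentagon side72_eq powers inv1[symmetric] k_def q_def[symmetric]
    by (simp only: divide_inverse mult_1_left mult_ac)
  also have "16 / 15 * ((q - 1) / 4) * (adjacent_sides_integral + (q + 2) * opposite_sides_integral) * ((5 - q) / 10)
      = (24 * q - 8 - (35 + 9 * q) * l - 2 * (25 + 11 * q) * l') / 480"
    unfolding A B c by (simp add: field_simps q q')
  finally show ?thesis
    unfolding k_def q_def l_def l'_def by simp
qed

text \<open>Convex hulls commute with the linear map and the translation; multiplication by
  \<open>rcis r\<close> of the first angle scales by r and turns the first vertex into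
  place.\<close>

lemma regular_polygon_5_eq:
  "regular_polygon 5 r c \<theta> = (\<lambda>z. c + rcis r \<theta> * z) ` pentagon"
proof -
  have "(\<lambda>z. c + rcis r \<theta> * z) ` pentagon = (\<lambda>z. c + z) ` (\<lambda>z. rcis r \<theta> * z) ` pentagon"
    by (simp add: image_image)
  also have "\<dots> = convex hull ((\<lambda>z. c + z) ` (\<lambda>z. rcis r \<theta> * z) ` vtx ` {..<5})"
    unfolding pentagon_def by (simp add: convex_hull_linear_image[OF linear_times] convex_hull_translation)
  also have "(\<lambda>z. c + z) ` (\<lambda>z. rcis r \<theta> * z) ` vtx ` {..<5} = (\<lambda>k. c + rcis r (\<theta> + 2 * pi * real k / real 5)) ` {..<5}"
    unfolding image_image by (intro image_cong refl) (simp add: pentagon_vertex_def rcis_def cis_mult)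
  finally show ?thesis unfolding regular_polygon_def by simp
qed

theorem mainTheorem4:
  fixes r :: real and c :: complex and \<theta> :: real
  assumes "r > 0"
  shows "mean_distance (regular_polygon 5 r c \<theta>) / r =
    sqrt 2 / 480 * sqrt (5 + sqrt 5) *
      (24 * sqrt 5 - 8 - (35 + 9 * sqrt 5) * ln 5
        - 2 * (25 + 11 * sqrt 5) * ln (sqrt 5 - 2))"
proof -
  have "mean_distance (regular_polygon 5 r c \<theta>) = norm (rcis r \<theta>) * mean_distance pentagon"
    unfolding regular_polygon_5_eq
  proof (rule mean_distance_similarity)
    show "emeasure lborel pentagon \<noteq> 0" "emeasure lborel pentagon \<noteq> \<infinity>"
      using s72_pos c72_bounds by (simp_all add: emeasure_pentagon_eq)
    have "compact ((\<lambda>z. c + rcis r \<theta> * z) ` pentagon)"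
      by (intro compact_continuous_image compact_pentagon continuous_intros)
    then show "(\<lambda>z. c + rcis r \<theta> * z) ` pentagon \<in> sets borel"
      by (intro borel_closed compact_imp_closed)
  qed (use assms in \<open>auto simp: rcis_def\<close>)
  then show ?thesis
    using assms by (simp add: rcis_def norm_mult mean_distance_pentagon_closed_form)
qed

end
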